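(* Let $(S,A,\Gamma,p,U,r,\beta)$ be a discounted dynamic programming model as described in the context, with Bellman operator $T$, value function $V$, and sets $\Lambda_f$. Let $D\subseteq B_m(S)$ be a set that is a complete metric space under the metric $d_\infty(f,g)=\sup_{s\in S}|f(s)-g(s)|$, that contains the constant function $0$, and that contains, for every $f\in D$, the constant function equal to $\sup_{s\in S}f(s)$. Assume that for every $f\in D$ we have $\Lambda_f\neq\emptyset$ and $Tf\in D$. Then: 1. $V$ is the unique function in $D$ that satisfies the Bellman equation: $V\in D$, $TV=V$, and if $f\in D$ satisfies $Tf=f$ then $f=V$. 2. There is a stationary policy $\lambda\in\Lambda_V$ that is $\epsilon$-optimal. 3. If $\lambda\in\Lambda_V$ achieves the supremum, i.e. $\sup_{a\in\Gamma(s)}Q(s,a,V)=Q(s,\lambda(s),V)$ for all $s\in S$, then $\lambda$ is an optimal stationary policy, i.e. the stationary strategy $\sigma$ that plays according to $\lambda$ satisfies $V_\sigma(s)=V(s)$ for all $s\in S$.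
   Context: **Model.** The state space $S$ and action space $A$ are Borel spaces (Borel subsets of complete separable metric spaces); $\mathcal{B}(X)$ denotes the Borel sigma-algebra of $X$. One fixes, uniformly for all such spaces $X$, a sigma-algebra $\mathcal{U}(X)$ which is one of the following three: the Borel sets of $X$; the universally measurable sets of $X$ (sets measurable with respect to the completion of every Borel probability measure on $X$); or all subsets of $X$. A function $f:X\to Y$ is $\mathcal{U}$-measurable if $f^{-1}(B)\in\mathcal{U}(X)$ for all $B\in\mathcal{B}(Y)$, and $U(X,Y)$ is the set of all $\mathcal{U}$-measurable functions $X\to Y$. The set $\Gamma\subseteq S\times A$ is Borel, and for each $s\in S$ the section $\Gamma(s)=\{a\in A:(s,a)\in\Gamma\}$ (the feasible actions in state $s$) is non-empty and Borel. The function $p:S\times A\times\mathcal{B}(S)\to[0,1]$ is such that $p(s,a,\cdot)$ is a probability measure on $(S,\mathcal{B}(S))$ for each $(s,a)$, and $p(\cdot,\cdot,B)$ is $\mathcal{U}$-measurable for each $B\in\mathcal{B}(S)$. The payoff $r:S\times A\to\mathbb{R}$ is bounded from below and $\mathcal{U}$-measurable. The discount factor satisfies $0<\beta<1$. Integrals and expectations of $\mathcal{U}$-measurable functions are taken with respect to the completions of the relevant probability measures; the model presupposes that the induced measures, integrals and expectations written below are well defined (a proviso that has content only in the third case, where $\mathcal{U}(X)$ consists of all subsets). **Strategies.** Let $H^t=S\times(A\times S)^{t-1}$. A strategy $\sigma$ is a sequence $(\sigma_1,\sigma_2,\ldots)$ with $\sigma_t\in U(H^t,A)$ and $\sigma_t(s(1),a(1),\ldots,s(t))\in\Gamma(s(t))$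 for all $t$ and all histories. Given an initial state $s(1)=s$, a strategy $\sigma$ and $p$ induce a probability measure on infinite histories, under which $a(t)=\sigma_t(s(1),a(1),\ldots,s(t))$ and the conditional law of $s(t+1)$ given the history up to and including $a(t)$ is $p(s(t),a(t),\cdot)$; $\mathbb{E}_\sigma$ is the corresponding expectation. Put $$V_\sigma(s)=\mathbb{E}_\sigma\sum_{t=1}^\infty\beta^{t-1}r(s(t),a(t)),\qquad V(s)=\sup_\sigma V_\sigma(s),$$ where $s(1)=s$ and the supremum is over all strategies; $V$ is the value function. A strategy $\sigma$ is optimal if $V_\sigma(s)=V(s)$ for all $s\in S$. A strategy $\sigma$ is called $\epsilon$-optimal if for every $\epsilon>0$, every strategy $\sigma'$ and every $s\in S$, $V_{\sigma'}(s)\le V_\sigma(s)+\epsilon$. A strategy is stationary if there is a function $\lambda\in U(S,A)$ (necessarily with $\lambda(s)\in\Gamma(s)$ for all $s$), called a stationary policy, such that $\sigma_t(s(1),a(1),\ldots,s(t))=\lambda(s(t))$ for all $t$ and all histories; a stationary policy is called optimal or $\epsilon$-optimal if the corresponding stationary strategy is. **Operators.** For $f\in U(S,\mathbb{R})$, $$Q(s,a,f)=r(s,a)+\beta\int_S f(s')\,p(s,a,ds'),\qquad Tf(s)=\sup_{a\in\Gamma(s)}Q(s,a,f),$$ $$\Lambda_f=\{\lambda\in U(S,A):\ \lambda(s)\in\Gamma(s)\text{ and }\sup_{a\in\Gamma(s)}Q(s,a,f)=Q(s,\lambda(s),f)\ \ \forall s\in S\}.$$ **Function space.** $B(S)$ is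 the space of all bounded real-valued functions on $S$ with the sup-norm, and $B_m(S)=B(S)\cap U(S,\mathbb{R})$. *)

theory Defs
  imports "HOL-Probability.Probability"
begin

text \<open>A Borel space \<open>X\<close> is represented by a measure \<open>X\<close> of which only the carrier and the
  (Borel) sigma-algebra matter.\<close>

datatype umode = Borel_sets | Universally_measurable_sets | All_sets

definition usets :: "umode \<Rightarrow> 'x measure \<Rightarrow> 'x set set" where
  "usets u X = (case u of
      Borel_sets \<Rightarrow> sets X
    | Universally_measurable_sets \<Rightarrow>
        {B. B \<subseteq> space X \<and>
            (\<forall>\<mu>. prob_space \<mu> \<and> sets \<mu> = sets X \<longrightarrow> B \<in> sets (completion \<mu>))}
    | All_sets \<Rightarrow> Pow (space X))"

definition umeas :: "umode \<Rightarrow> 'x measure \<Rightarrow> 'y measure \<Rightarrow> ('x \<Rightarrow> 'y) set" where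
  "umeas u X Y = {f \<in> space X \<rightarrow> space Y. \<forall>B\<in>sets Y. f -` B \<inter> space X \<in> usets u X}"

record ('s, 'a) ddp =
  mode :: umode
  states :: "'s set"
  actions :: "'a set"
  feas :: "('s \<times> 'a) set"
  trans :: "'s \<Rightarrow> 'a \<Rightarrow> 's measure"
  payoff :: "'s \<Rightarrow> 'a \<Rightarrow> real"
  discount :: real

definition SB :: "('s::polish_space, 'a::polish_space) ddp \<Rightarrow> 's measure" where
  "SB M = restrict_space borel (states M)"

definition AB :: "('s::polish_space, 'a::polish_space) ddp \<Rightarrow> 'a measure" where
  "AB M = restrict_space borel (actions M)"

definition \<Gamma> :: "('s, 'a) ddp \<Rightarrow> 's \<Rightarrow> 'a set" where
  "\<Gamma> M s = {a \<in> actions M. (s, a) \<in> feas M}"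

text \<open>Time is counted from \<open>0\<close>: date \<open>t\<close> below is date \<open>t + 1\<close> of the usual notation
  \<open>s(1), a(1), s(2), \<dots>\<close>. A history up to date \<open>t\<close> is an element of \<open>S \<times> (A \<times> S)\<^sup>t\<close>, an
  infinite history is an element of \<open>S \<times> (A \<times> S)\<^sup>\<omega>\<close>; the entry with index \<open>i\<close> of the second
  component consists of the action at date \<open>i\<close> and the state at date \<open>Suc i\<close>. As the factors are
  second countable, the product sigma-algebras are the Borel sigma-algebras of the products.\<close>

type_synonym ('s, 'a) history = "'s \<times> (nat \<Rightarrow> 'a \<times> 's)"

definition Hist :: "('s::polish_space, 'a::polish_space) ddp \<Rightarrow> nat \<Rightarrow> ('s, 'a) history measure"
  where "Hist M t = SB M \<Otimes>\<^sub>M PiM {..<t} (\<lambda>_. AB M \<Otimes>\<^sub>M SB M)"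

definition Hinf :: "('s::polish_space, 'a::polish_space) ddp \<Rightarrow> ('s, 'a) history measure"
  where "Hinf M = SB M \<Otimes>\<^sub>M PiM UNIV (\<lambda>_. AB M \<Otimes>\<^sub>M SB M)"

definition state :: "nat \<Rightarrow> ('s, 'a) history \<Rightarrow> 's" where
  "state t h = (case t of 0 \<Rightarrow> fst h | Suc i \<Rightarrow> snd (snd h i))"

definition act :: "nat \<Rightarrow> ('s, 'a) history \<Rightarrow> 'a" where
  "act t h = fst (snd h t)"

definition hist :: "nat \<Rightarrow> ('s, 'a) history \<Rightarrow> ('s, 'a) history" where
  "hist t h = (fst h, restrict (snd h) {..<t})"

type_synonym ('s, 'a) strategy = "nat \<Rightarrow> ('s, 'a) history \<Rightarrow> 'a"

definition strategies :: "('s::polish_space, 'a::polish_space) ddp \<Rightarrow> ('s, 'a) strategy set" where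
  "strategies M = {\<sigma>. \<forall>t. \<sigma> t \<in> umeas (mode M) (Hist M t) (AB M) \<and>
     (\<forall>h\<in>space (Hist M t). \<sigma> t h \<in> \<Gamma> M (state t h))}"

definition stationary_policy :: "('s::polish_space, 'a::polish_space) ddp \<Rightarrow> ('s \<Rightarrow> 'a) \<Rightarrow> bool"
  where "stationary_policy M l \<longleftrightarrow>
    l \<in> umeas (mode M) (SB M) (AB M) \<and> (\<forall>s\<in>states M. l s \<in> \<Gamma> M s)"

definition stationary_strategy :: "('s \<Rightarrow> 'a) \<Rightarrow> ('s, 'a) strategy" where
  "stationary_strategy l t h = l (state t h)"

text \<open>The last clause says that \<open>trans M (state t \<omega>) (act t \<omega>)\<close> is the conditional law of the
  next state given the history up to and including the action at date \<open>t\<close>. Nothing here requires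
  the functions \<open>\<sigma> t\<close> and \<open>trans M\<close> to be Borel: \<open>AE\<close> with respect to a measure and with respect
  to its completion are the same.\<close>

definition is_induced ::
  "('s::polish_space, 'a::polish_space) ddp \<Rightarrow> ('s, 'a) strategy \<Rightarrow> 's
    \<Rightarrow> ('s, 'a) history measure \<Rightarrow> bool" where
  "is_induced M \<sigma> s P \<longleftrightarrow>
     prob_space P \<and> sets P = sets (Hinf M) \<and>
     (AE \<omega> in P. state 0 \<omega> = s) \<and>
     (\<forall>t. AE \<omega> in P. act t \<omega> = \<sigma> t (hist t \<omega>)) \<and>
     (\<forall>t. \<forall>B\<in>sets (SB M). AE \<omega> in P.
        real_cond_exp P
          (vimage_algebra (space P) (\<lambda>\<omega>. (hist t \<omega>, act t \<omega>)) (Hist M t \<Otimes>\<^sub>M AB M))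
          (indicator {\<omega>\<in>space P. state (Suc t) \<omega> \<in> B}) \<omega>
        = measure (trans M (state t \<omega>) (act t \<omega>)) B)"

definition induced ::
  "('s::polish_space, 'a::polish_space) ddp \<Rightarrow> ('s, 'a) strategy \<Rightarrow> 's \<Rightarrow> ('s, 'a) history measure"
  where "induced M \<sigma> s = (THE P. is_induced M \<sigma> s P)"

text \<open>Extended real valued expectation with respect to the completion, as positive part minus
  negative part; \<open>e2ennreal\<close> maps negative numbers to \<open>0\<close>.\<close>

definition expect :: "'x measure \<Rightarrow> ('x \<Rightarrow> ereal) \<Rightarrow> ereal" where
  "expect P X = enn2ereal (\<integral>\<^sup>+ \<omega>. e2ennreal (X \<omega>) \<partial>completion P)
              - enn2ereal (\<integral>\<^sup>+ \<omega>. e2ennreal (- X \<omega>) \<partial>completion P)"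

text \<open>The payoff is bounded from below, but not necessarily from above, so values are extended
  reals.\<close>

definition strategy_value ::
  "('s::polish_space, 'a::polish_space) ddp \<Rightarrow> ('s, 'a) strategy \<Rightarrow> 's \<Rightarrow> ereal" where
  "strategy_value M \<sigma> s = expect (induced M \<sigma> s)
     (\<lambda>\<omega>. \<Sum>t. ereal (discount M ^ t * payoff M (state t \<omega>) (act t \<omega>)))"

definition value_function :: "('s::polish_space, 'a::polish_space) ddp \<Rightarrow> 's \<Rightarrow> ereal" where
  "value_function M s = (SUP \<sigma>\<in>strategies M. strategy_value M \<sigma> s)"

definition optimal :: "('s::polish_space, 'a::polish_space) ddp \<Rightarrow> ('s, 'a) strategy \<Rightarrow> bool" where
  "optimal M \<sigma> \<longleftrightarrow> \<sigma> \<in> strategies M \<and>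
     (\<forall>s\<in>states M. strategy_value M \<sigma> s = value_function M s)"

definition eps_optimal :: "('s::polish_space, 'a::polish_space) ddp \<Rightarrow> ('s, 'a) strategy \<Rightarrow> bool"
  where "eps_optimal M \<sigma> \<longleftrightarrow> \<sigma> \<in> strategies M \<and>
     (\<forall>\<epsilon>::real. \<epsilon> > 0 \<longrightarrow> (\<forall>\<sigma>'\<in>strategies M. \<forall>s\<in>states M.
        strategy_value M \<sigma>' s \<le> strategy_value M \<sigma> s + ereal \<epsilon>))"

text \<open>If every set counts as measurable, integrals with respect to Borel measures need not make
  sense, and the model presupposes that they do. In the other two cases the corresponding
  properties hold automatically.\<close>

definition well_posed :: "('s::polish_space, 'a::polish_space) ddp \<Rightarrow> bool" where
  "well_posed M \<longleftrightarrow>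
     (\<forall>s\<in>states M. \<forall>a\<in>\<Gamma> M s. usets (mode M) (SB M) \<subseteq> sets (completion (trans M s a))) \<and>
     (\<forall>\<sigma>\<in>strategies M. \<forall>s\<in>states M. \<exists>P. is_induced M \<sigma> s P \<and>
        (\<forall>t. usets (mode M) (Hist M t) \<subseteq> sets (completion (distr P (Hist M t) (hist t)))))"

definition ddp_model :: "('s::polish_space, 'a::polish_space) ddp \<Rightarrow> bool" where
  "ddp_model M \<longleftrightarrow>
     states M \<in> sets borel \<and> actions M \<in> sets borel \<and>
     feas M \<in> sets (SB M \<Otimes>\<^sub>M AB M) \<and>
     (\<forall>s\<in>states M. \<Gamma> M s \<noteq> {} \<and> \<Gamma> M s \<in> sets (AB M)) \<and>
     (\<forall>s\<in>states M. \<forall>a\<in>actions M. prob_space (trans M s a) \<and> sets (trans M s a) = sets (SB M)) \<and>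
     (\<forall>B\<in>sets (SB M).
        (\<lambda>(s, a). measure (trans M s a) B) \<in> umeas (mode M) (SB M \<Otimes>\<^sub>M AB M) borel) \<and>
     (\<lambda>(s, a). payoff M s a) \<in> umeas (mode M) (SB M \<Otimes>\<^sub>M AB M) borel \<and>
     (\<exists>c. \<forall>s\<in>states M. \<forall>a\<in>actions M. c \<le> payoff M s a) \<and>
     0 < discount M \<and> discount M < 1 \<and>
     (mode M = All_sets \<longrightarrow> well_posed M)"

text \<open>Functions on \<open>S\<close> are extensional, so that equality of functions is equality on \<open>S\<close>.
  \<open>funspace (states M) euclidean_metric\<close> is the space of bounded functions with the sup-metric.\<close>

definition Bm :: "('s::polish_space, 'a::polish_space) ddp \<Rightarrow> ('s \<Rightarrow> real) set" where
  "Bm M = mspace (funspace (states M) euclidean_metric) \<inter> umeas (mode M) (SB M) borel"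

text \<open>\<open>Q\<close> is used only for bounded \<open>f\<close>, where the Bochner integral is the usual integral. The
  supremum defining \<open>bellman\<close> is taken in the extended reals, since it may be infinite.\<close>

definition Q :: "('s, 'a) ddp \<Rightarrow> 's \<Rightarrow> 'a \<Rightarrow> ('s \<Rightarrow> real) \<Rightarrow> real" where
  "Q M s a f = payoff M s a + discount M * (\<integral>s'. f s' \<partial>completion (trans M s a))"

definition bellman :: "('s, 'a) ddp \<Rightarrow> ('s \<Rightarrow> real) \<Rightarrow> 's \<Rightarrow> ereal" where
  "bellman M f s = (SUP a\<in>\<Gamma> M s. ereal (Q M s a f))"

definition \<Lambda> :: "('s::polish_space, 'a::polish_space) ddp \<Rightarrow> ('s \<Rightarrow> real) \<Rightarrow> ('s \<Rightarrow> 'a) set" where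
  "\<Lambda> M f = {l \<in> umeas (mode M) (SB M) (AB M).
     \<forall>s\<in>states M. l s \<in> \<Gamma> M s \<and> bellman M f s = ereal (Q M s (l s) f)}"

definition equals_on :: "'s set \<Rightarrow> ('s \<Rightarrow> ereal) \<Rightarrow> ('s \<Rightarrow> real) \<Rightarrow> bool" where
  "equals_on S F f \<longleftrightarrow> (\<forall>s\<in>S. F s = ereal (f s))"

end

theory Submission
  imports Defs
begin

text \<open>The Bellman operator is a contraction of \<open>D\<close> with modulus the discount factor, so it has a fixed
  point \<open>V \<in> D\<close> (applied to \<open>0\<close> it also shows that the payoff is bounded on feasible pairs). Along the
  measure induced by a strategy, \<open>r + \<beta> \<integral>V dp \<le> V\<close> telescopes to \<open>V\<^sub>\<sigma> \<le> V\<close>, with equality when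
  actions attain the supremum.

  Strategies and transition probabilities need not be Borel, but with respect to the law of a fixed
  finite history they agree almost everywhere with Borel maps and Borel kernels. This turns the
  conditional law in the definition of the induced measure into a disintegration over a Borel kernel,
  from which uniqueness follows by induction on the date, existence from the Ionescu-Tulcea theorem,
  and the telescoping from Fubini's theorem.\<close>

section \<open>Generalised measurability\<close>

text \<open>The obstacle is that a Borel version is tied to a measure: the kernel replacing a
  non-Borel one agrees with it only outside a null set of the law of the history, and this law
  depends on the kernels of all earlier dates. Versions are therefore chosen date by date. For
  existence, each kernel is a version with respect to the law already built from its predecessors.
  For uniqueness, the induction hypothesis identifies the two laws of the history, so that one
  version serves both measures. When every set counts as measurable, completions are controlled only
  by \<open>well_posed\<close>, which speaks of laws of finite histories and of transition laws at
  feasible pairs. Along a strategy, generalised measurability is therefore always used for functions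
  of a finite history. Uniqueness of the fixed point comes from the telescoping argument as well: it
  applies to every bounded fixed point of the Bellman operator that has a maximiser, and identifies
  it with the value function.\<close>

definition UM :: "umode \<Rightarrow> 'x measure \<Rightarrow> 'x measure" where
  "UM u X = sigma (space X) (usets u X)"

text \<open>In the universally measurable case the family is an intersection of the sigma-algebras
  of the completions, one for each Borel probability measure.\<close>

lemma sigma_algebra_usets: "sigma_algebra (space X) (usets u X)"
proof (cases u)
  case Borel_sets
  then show ?thesis by (simp add: usets_def sets.sigma_algebra_axioms)
next
  case All_sets
  then show ?thesis by (simp add: usets_def sigma_algebra_Pow)
next
  case Universally_measurable_sets
  have eq: "usets u X = {B. B \<subseteq> space X \<and>
      (\<forall>\<mu>. prob_space \<mu> \<and> sets \<mu> = sets X \<longrightarrow> B \<in> sets (completion \<mu>))}"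
    using Universally_measurable_sets by (simp add: usets_def)
  have 1: "B \<in> usets u X \<longleftrightarrow> B \<subseteq> space X \<and>
      (\<forall>\<mu>. prob_space \<mu> \<and> sets \<mu> = sets X \<longrightarrow> B \<in> sets (completion \<mu>))" for B
    unfolding eq by blast
  show ?thesis
    unfolding sigma_algebra_iff2
  proof (intro conjI ballI allI impI)
    show "usets u X \<subseteq> Pow (space X)" unfolding eq by blast
    show "{} \<in> usets u X" unfolding 1 by simp
    fix B assume B: "B \<in> usets u X"
    have "space X - B \<in> sets (completion \<mu>)" if "prob_space \<mu>" "sets \<mu> = sets X" for \<mu>
    proof -
      have "B \<in> sets (completion \<mu>)" using B that unfolding 1 by blast
      then have "space (completion \<mu>) - B \<in> sets (completion \<mu>)" by (rule sets.compl_sets)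
      then show ?thesis using sets_eq_imp_space_eq[OF that(2)] by simp
    qed
    then show "space X - B \<in> usets u X" unfolding 1 by blast
  next
    fix B :: "nat \<Rightarrow> _" assume B: "range B \<subseteq> usets u X"
    have "(\<Union>i. B i) \<in> sets (completion \<mu>)" if "prob_space \<mu>" "sets \<mu> = sets X" for \<mu>
      by (rule sets.countable_UN) (use B that 1 in blast)
    moreover have "(\<Union>i. B i) \<subseteq> space X" using B unfolding eq by blast
    ultimately show "(\<Union>i. B i) \<in> usets u X" unfolding 1 by blast
  qed
qed

lemma space_UM [simp]: "space (UM u X) = space X"
  unfolding UM_def by (rule sigma_algebra.space_measure_of_eq[OF sigma_algebra_usets])

lemma sets_UM [simp]: "sets (UM u X) = usets u X"
  unfolding UM_def by (rule sigma_algebra.sets_measure_of_eq[OF sigma_algebra_usets])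

text \<open>With this, generalised measurability is ordinary measurability out of
  \<open>UM u X\<close>, so that pairing, limits and kernels are treated by the usual rules for all
  three modes at once.\<close>

lemma umeas_eq_measurable: "umeas u X Y = UM u X \<rightarrow>\<^sub>M Y"
  by (auto simp: umeas_def measurable_def)

lemma sets_subset_usets: "sets X \<subseteq> usets u X"
  using sets.sets_into_space by (cases u) (auto simp: usets_def)

lemma measurable_UM: "f \<in> X \<rightarrow>\<^sub>M Y \<Longrightarrow> f \<in> UM u X \<rightarrow>\<^sub>M Y"
  using sets_subset_usets[of X u] by (auto simp: measurable_def)

text \<open>This is where the modes part: if every set counts as measurable, the inclusion has to
  come from \<open>well_posed\<close>.\<close>

lemma usets_subset_completion:
  assumes "u \<noteq> All_sets" "prob_space \<mu>" "sets \<mu> = sets X"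
  shows "usets u X \<subseteq> sets (completion \<mu>)"
  using assms by (cases u) (auto simp: usets_def)

lemma measurable_completion_UM:
  assumes "usets u X \<subseteq> sets (completion \<mu>)" "sets \<mu> = sets X" "f \<in> UM u X \<rightarrow>\<^sub>M Y"
  shows "f \<in> completion \<mu> \<rightarrow>\<^sub>M Y"
  using assms sets_eq_imp_space_eq[OF assms(2)] by (auto simp: measurable_def)

text \<open>In the universally measurable case, test a set in the range against the image of \<open>\<mu>\<close> under \<open>f\<close>.\<close>

lemma UM_lift:
  assumes f: "f \<in> UM u X \<rightarrow>\<^sub>M Y"
  shows "f \<in> UM u X \<rightarrow>\<^sub>M UM u Y"
proof (rule measurableI)
  show "f x \<in> space (UM u Y)" if "x \<in> space (UM u X)" for x
    using measurable_space[OF f that] by simp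
  fix B assume "B \<in> sets (UM u Y)"
  then have B: "B \<in> usets u Y" by simp
  show "f -` B \<inter> space (UM u X) \<in> sets (UM u X)"
  proof (cases u)
    case Borel_sets
    then have "B \<in> sets Y" using B by (simp add: usets_def)
    then show ?thesis using measurable_sets[OF f] by simp
  next
    case All_sets
    then show ?thesis by (auto simp: usets_def)
  next
    case Universally_measurable_sets
    have "f -` B \<inter> space X \<in> sets (completion \<mu>)" if "prob_space \<mu>" and s: "sets \<mu> = sets X" for \<mu>
    proof -
      interpret prob_space \<mu> by fact
      interpret c: prob_space "completion \<mu>"
        by (rule prob_spaceI) (simp add: emeasure_space_1)
      have us: "usets u X \<subseteq> sets (completion \<mu>)"
        by (rule usets_subset_completion) (use Universally_measurable_sets that in auto)
      have fc: "f \<in> completion \<mu> \<rightarrow>\<^sub>M Y"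
        by (rule measurable_completion_UM[OF us s f])
      let ?\<nu> = "distr (completion \<mu>) Y f"
      have "prob_space ?\<nu>" by (rule c.prob_space_distr[OF fc])
      then have "B \<in> sets (completion ?\<nu>)"
        using B Universally_measurable_sets by (auto simp: usets_def)
      moreover have "f \<in> completion \<mu> \<rightarrow>\<^sub>M completion ?\<nu>"
      proof (rule completion.measurable_completion2)
        show "f \<in> completion \<mu> \<rightarrow>\<^sub>M ?\<nu>" using fc by simp
        have "distr (completion \<mu>) ?\<nu> f = ?\<nu>" by (rule distr_cong) auto
        then show "null_sets ?\<nu> \<subseteq> null_sets (distr (completion \<mu>) ?\<nu> f)" by simp
      qed
      ultimately show ?thesis
        using measurable_sets[of f "completion \<mu>" "completion ?\<nu>" B] sets_eq_imp_space_eq[OF s] by simp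
    qed
    then show ?thesis using Universally_measurable_sets by (auto simp: usets_def)
  qed
qed

text \<open>The outer function pulls Borel sets back to generalised measurable sets only, so the
  inner one must be measurable for those too; \<open>UM_lift\<close> provides this.\<close>

lemma UM_compose:
  assumes "f \<in> UM u X \<rightarrow>\<^sub>M Y" "g \<in> UM u Y \<rightarrow>\<^sub>M Z"
  shows "(\<lambda>x. g (f x)) \<in> UM u X \<rightarrow>\<^sub>M Z"
  using measurable_compose[OF UM_lift[OF assms(1)] assms(2)] .

section \<open>Borel versions of completion measurable maps\<close>

text \<open>Finite intersections of members of a countable base, cut down to \<open>C\<close>; the
  empty family contributes \<open>C\<close> itself. Countability lets the exceptional null sets be
  united into one, and stability under intersections lets a generator test the measurability of a
  kernel.\<close>

lemma countable_Int_stable_generator: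
  fixes C :: "'y::second_countable_topology set"
  assumes C: "C \<in> sets borel"
  obtains G where "countable G" "Int_stable G" "G \<subseteq> Pow C" "C \<in> G"
    "sets (restrict_space borel C) = sigma_sets C G"
proof -
  obtain B :: "'y set set" where B: "countable B" "topological_basis B"
    using ex_countable_basis by blast
  define G where "G = (\<lambda>F. C \<inter> \<Inter>F) ` {F. finite F \<and> F \<subseteq> B}"
  have "countable G"
    unfolding G_def by (intro countable_image countable_Collect_finite_subset B)
  moreover have "Int_stable G"
  proof (rule Int_stableI)
    fix a b assume "a \<in> G" "b \<in> G"
    then obtain F F' where "finite F" "F \<subseteq> B" "a = C \<inter> \<Inter>F" "finite F'" "F' \<subseteq> B" "b = C \<inter> \<Inter>F'"
      unfolding G_def by blast
    then show "a \<inter> b \<in> G"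
      unfolding G_def by (intro image_eqI[of _ _ "F \<union> F'"]) auto
  qed
  moreover have GC: "G \<subseteq> Pow C" "C \<in> G"
    unfolding G_def by (blast, intro image_eqI[of _ _ "{}"]) auto
  moreover have "sets (restrict_space borel C) = sigma_sets C G"
  proof -
    have 1: "sets (restrict_space borel C) = sigma_sets C ((\<inter>) C ` B)"
    proof -
      have "sets (borel :: 'y measure) = sigma_sets UNIV B"
        unfolding borel_eq_countable_basis[OF B] by (rule sets_measure_of) simp
      then show ?thesis
        using sigma_sets_Int[of C UNIV B] C by (simp add: sets_restrict_space)
    qed
    have 2: "(\<inter>) C ` B \<subseteq> G"
    proof
      fix a assume "a \<in> (\<inter>) C ` B"
      then obtain b where "b \<in> B" "a = C \<inter> b" by blast
      then show "a \<in> G"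
        unfolding G_def by (intro image_eqI[of _ _ "{b}"]) auto
    qed
    have 3: "G \<subseteq> sigma_sets C ((\<inter>) C ` B)"
    proof
      fix a assume "a \<in> G"
      then obtain F where F: "finite F" "F \<subseteq> B" "a = C \<inter> \<Inter>F" unfolding G_def by blast
      interpret sigma_algebra C "sigma_sets C ((\<inter>) C ` B)"
        by (rule sigma_algebra_sigma_sets) auto
      show "a \<in> sigma_sets C ((\<inter>) C ` B)"
      proof (cases "F = {}")
        case True
        then have "a = C" using F(3) by simp
        then show ?thesis using sigma_sets_top[of C "(\<inter>) C ` B"] by (simp only:)
      next
        case False
        then have "a = (\<Inter>b\<in>F. C \<inter> b)" unfolding F(3) by blast
        moreover have "(\<Inter>b\<in>F. C \<inter> b) \<in> sigma_sets C ((\<inter>) C ` B)"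
        proof (rule finite_INT[OF F(1) False])
          fix b assume "b \<in> F"
          then show "C \<inter> b \<in> sigma_sets C ((\<inter>) C ` B)" using F(2) by (intro sigma_sets.Basic) blast
        qed
        ultimately show ?thesis by (simp only:)
      qed
    qed
    show ?thesis
      unfolding 1 by (rule antisym[OF sigma_sets_mono'[OF 2] sigma_sets_mono[OF 3]])
  qed
  ultimately show thesis by (rule that)
qed

text \<open>Each function is Borel off its own null set, and countably many null sets have a null
  union. The functions are restricted, not altered: altered one by one, the functions attached to
  the generator sets might no longer belong to a single map or a single measure.\<close>

lemma completion_countable_borel:
  fixes g :: "'i \<Rightarrow> 'x \<Rightarrow> ennreal"
  assumes I: "countable I" and g: "\<And>i. i \<in> I \<Longrightarrow> g i \<in> borel_measurable (completion \<mu>)"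
  shows "\<exists>N\<in>null_sets \<mu>. \<forall>i\<in>I. g i \<in> borel_measurable (restrict_space \<mu> (- N))"
proof -
  have "\<exists>p. fst p \<in> borel_measurable \<mu> \<and> snd p \<in> null_sets \<mu> \<and>
      {x\<in>space \<mu>. g i x \<noteq> fst p x} \<subseteq> snd p" if i: "i \<in> I" for i
  proof -
    obtain h where "h \<in> borel_measurable \<mu>" "AE x in \<mu>. g i x = h x"
      using completion_ex_borel_measurable[OF g[OF i]] by blast
    moreover from this(2) obtain N where "N \<in> null_sets \<mu>" "{x\<in>space \<mu>. g i x \<noteq> h x} \<subseteq> N"
      unfolding eventually_ae_filter by blast
    ultimately show ?thesis by (intro exI[of _ "(h, N)"]) simp
  qed
  then have "\<exists>p. \<forall>i\<in>I. fst (p i) \<in> borel_measurable \<mu> \<and> snd (p i) \<in> null_sets \<mu> \<and>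
      {x\<in>space \<mu>. g i x \<noteq> fst (p i) x} \<subseteq> snd (p i)"
    by (intro bchoice) blast
  then obtain p where p: "\<And>i. i \<in> I \<Longrightarrow> fst (p i) \<in> borel_measurable \<mu> \<and> snd (p i) \<in> null_sets \<mu> \<and>
      {x\<in>space \<mu>. g i x \<noteq> fst (p i) x} \<subseteq> snd (p i)" by blast
  define h N where "h i = fst (p i)" and "N i = snd (p i)" for i
  have h: "h i \<in> borel_measurable \<mu>" and N: "N i \<in> null_sets \<mu>"
    and gh: "{x\<in>space \<mu>. g i x \<noteq> h i x} \<subseteq> N i" if "i \<in> I" for i
    using p[OF that] by (auto simp: h_def N_def)
  have "g i \<in> borel_measurable (restrict_space \<mu> (- (\<Union>i\<in>I. N i)))" if "i \<in> I" for i
  proof -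
    have "h i \<in> borel_measurable (restrict_space \<mu> (- (\<Union>i\<in>I. N i)))"
      using h[OF that] by (rule measurable_restrict_space1)
    then show ?thesis
    proof (rule measurable_cong[THEN iffD1, rotated])
      fix x assume "x \<in> space (restrict_space \<mu> (- (\<Union>i\<in>I. N i)))"
      then show "h i x = g i x" using that gh[OF that] by (auto simp: space_restrict_space)
    qed
  qed
  moreover have "(\<Union>i\<in>I. N i) \<in> null_sets \<mu>"
    using I N by (intro null_sets_UN') auto
  ultimately show ?thesis by blast
qed

text \<open>A map is measurable as soon as the preimages of a generator are. Applied to the
  indicators of a countable generator, the preceding lemma yields one null set off which the map
  itself is Borel.\<close>

lemma completion_ex_borel_map:
  fixes C :: "'y::second_countable_topology set"
  assumes \<mu>: "space \<mu> \<noteq> {}" and C: "C \<in> sets borel" and Y: "sets Y = sets (restrict_space borel C)"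
    and f: "f \<in> completion \<mu> \<rightarrow>\<^sub>M Y"
  shows "\<exists>f'. f' \<in> \<mu> \<rightarrow>\<^sub>M Y \<and> (AE x in \<mu>. f' x = f x)"
proof -
  obtain G where G: "countable G" "Int_stable G" "G \<subseteq> Pow C" "C \<in> G"
    "sets (restrict_space borel C) = sigma_sets C G"
    by (rule countable_Int_stable_generator[OF C])
  have spY: "space Y = C"
    using sets_eq_imp_space_eq[OF Y] by (simp add: space_restrict_space)
  have GY: "A \<in> sets Y" if "A \<in> G" for A
    unfolding Y G(5) by (rule sigma_sets.Basic[OF that])
  have "(\<lambda>x. indicator A (f x) :: ennreal) \<in> borel_measurable (completion \<mu>)" if "A \<in> G" for A
    by (rule measurable_compose[OF f]) (use GY[OF that] in simp)
  from completion_countable_borel[OF G(1), of "\<lambda>A x. indicator A (f x)", OF this] obtain N where N: "N \<in> null_sets \<mu>"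
    and fN: "\<And>A. A \<in> G \<Longrightarrow> (\<lambda>x. indicator A (f x) :: ennreal) \<in> borel_measurable (restrict_space \<mu> (- N))"
    by blast
  have fN': "f \<in> restrict_space \<mu> (- N) \<rightarrow>\<^sub>M Y"
  proof (rule measurable_sigma_sets)
    show "sets Y = sigma_sets C G" using Y G by simp
    show "G \<subseteq> Pow C" by fact
    show "f \<in> space (restrict_space \<mu> (- N)) \<rightarrow> C"
      using measurable_space[OF f] spY by (auto simp: space_restrict_space)
    fix A assume "A \<in> G"
    have "f -` A \<inter> space (restrict_space \<mu> (- N)) =
        (\<lambda>x. indicator A (f x) :: ennreal) -` {1} \<inter> space (restrict_space \<mu> (- N))"
      by (auto split: split_indicator simp: indicator_def)
    also have "\<dots> \<in> sets (restrict_space \<mu> (- N))"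
      by (rule measurable_sets[OF fN[OF \<open>A \<in> G\<close>]]) simp
    finally show "f -` A \<inter> space (restrict_space \<mu> (- N)) \<in> sets (restrict_space \<mu> (- N))" .
  qed
  \<comment> \<open>On the null set the map is set to one of its own values, so that it still takes
    values in \<open>Y\<close>.\<close>
  obtain x0 where x0: "x0 \<in> space \<mu>" using \<mu> by blast
  let ?f = "\<lambda>x. if x \<in> - N then f x else f x0"
  have "?f \<in> \<mu> \<rightarrow>\<^sub>M Y"
    using measurable_restrict_space_iff[of "- N" \<mu> "f x0" Y f] fN' N x0 measurable_space[OF f, of x0]
    by (auto simp: Compl_eq_Diff_UNIV Diff_Int_distrib2)
  moreover have "AE x in \<mu>. ?f x = f x"
    using AE_not_in[OF N] by eventually_elim auto
  ultimately show ?thesis by blast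
qed

text \<open>The argument is the one for maps, with the masses of the generator sets in place of
  their indicators: for probability kernels these decide measurability, because the generator is
  stable under intersections.\<close>

lemma completion_ex_borel_kernel:
  fixes C :: "'y::second_countable_topology set"
  assumes \<mu>: "space \<mu> \<noteq> {}" and C: "C \<in> sets borel" and Y: "sets Y = sets (restrict_space borel C)"
    and K: "K \<in> completion \<mu> \<rightarrow>\<^sub>M prob_algebra Y"
  shows "\<exists>K'. K' \<in> \<mu> \<rightarrow>\<^sub>M prob_algebra Y \<and> (AE x in \<mu>. K' x = K x)"
proof -
  obtain G where G: "countable G" "Int_stable G" "G \<subseteq> Pow C" "C \<in> G"
    "sets (restrict_space borel C) = sigma_sets C G"
    by (rule countable_Int_stable_generator[OF C])
  have GY: "A \<in> sets Y" if "A \<in> G" for A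
    unfolding Y G(5) by (rule sigma_sets.Basic[OF that])
  have "(\<lambda>x. emeasure (K x) A) \<in> borel_measurable (completion \<mu>)" if "A \<in> G" for A
    by (rule measurable_compose[OF measurable_prob_algebraD[OF K]
          measurable_emeasure_subprob_algebra[OF GY[OF that]]])
  from completion_countable_borel[OF G(1), of "\<lambda>A x. emeasure (K x) A", OF this] obtain N where N: "N \<in> null_sets \<mu>"
    and KN: "\<And>A. A \<in> G \<Longrightarrow> (\<lambda>x. emeasure (K x) A) \<in> borel_measurable (restrict_space \<mu> (- N))"
    by blast
  have Kx: "prob_space (K x)" "sets (K x) = sets Y" if "x \<in> space \<mu>" for x
    using measurable_space[OF K, of x] that by (auto simp: space_prob_algebra)
  have KN': "K \<in> restrict_space \<mu> (- N) \<rightarrow>\<^sub>M prob_algebra Y"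
    by (rule measurable_prob_algebra_generated[of _ C G])
       (use Y G Kx KN in \<open>auto simp: space_restrict_space\<close>)
  obtain x0 where x0: "x0 \<in> space \<mu>" using \<mu> by blast
  let ?f = "\<lambda>x. if x \<in> - N then K x else K x0"
  have "?f \<in> \<mu> \<rightarrow>\<^sub>M prob_algebra Y"
    using measurable_restrict_space_iff[of "- N" \<mu> "K x0" "prob_algebra Y" K] KN' N x0
      measurable_space[OF K, of x0]
    by (auto simp: Compl_eq_Diff_UNIV Diff_Int_distrib2)
  moreover have "AE x in \<mu>. ?f x = K x"
    using AE_not_in[OF N] by eventually_elim auto
  ultimately show ?thesis by blast
qed

section \<open>Histories\<close>

definition ext :: "nat \<Rightarrow> ('s, 'a) history \<times> 'a \<times> 's \<Rightarrow> ('s, 'a) history" where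
  "ext t p = (fst (fst p), (snd (fst p))(t := snd p))"

lemma hist_Suc: "hist (Suc t) \<omega> = ext t (hist t \<omega>, snd \<omega> t)"
  by (auto simp: hist_def ext_def fun_eq_iff)

lemma state_hist [simp]: "state t (hist t \<omega>) = state t \<omega>"
  by (auto simp: state_def hist_def split: nat.split)

lemma state_ext [simp]: "state (Suc t) (ext t p) = snd (snd p)"
  by (simp add: state_def ext_def)

lemma state_Suc: "state (Suc t) \<omega> = snd (snd \<omega> t)"
  by (simp add: state_def)

lemma state_0 [simp]: "state 0 \<omega> = fst \<omega>"
  by (simp add: state_def)

text \<open>A conditional law given history and action is tested on sets with a condition on the
  first two coordinates jointly and one on the third. These are the rectangles of the other
  bracketing of the product, an intersection-stable generator there; the measures are moved to that
  bracketing and back.\<close>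

lemma measure_eqI_assoc:
  assumes \<mu>: "finite_measure \<mu>" "sets \<mu> = sets (X \<Otimes>\<^sub>M (Y \<Otimes>\<^sub>M Z))"
    and \<nu>: "sets \<nu> = sets (X \<Otimes>\<^sub>M (Y \<Otimes>\<^sub>M Z))"
    and eq: "\<And>D E. D \<in> sets (X \<Otimes>\<^sub>M Y) \<Longrightarrow> E \<in> sets Z \<Longrightarrow>
      emeasure \<mu> {p\<in>space (X \<Otimes>\<^sub>M (Y \<Otimes>\<^sub>M Z)). (fst p, fst (snd p)) \<in> D \<and> snd (snd p) \<in> E} =
      emeasure \<nu> {p\<in>space (X \<Otimes>\<^sub>M (Y \<Otimes>\<^sub>M Z)). (fst p, fst (snd p)) \<in> D \<and> snd (snd p) \<in> E}"
  shows "\<mu> = \<nu>"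
proof -
  let ?W = "X \<Otimes>\<^sub>M (Y \<Otimes>\<^sub>M Z)" and ?W' = "(X \<Otimes>\<^sub>M Y) \<Otimes>\<^sub>M Z"
  let ?f = "\<lambda>p. ((fst p, fst (snd p)), snd (snd p))"
  let ?g = "\<lambda>p. (fst (fst p), (snd (fst p), snd p))"
  have f: "?f \<in> ?W \<rightarrow>\<^sub>M ?W'" by measurable
  have g: "?g \<in> ?W' \<rightarrow>\<^sub>M ?W" by measurable
  have f\<mu>: "?f \<in> \<mu> \<rightarrow>\<^sub>M ?W'" using f measurable_cong_sets[OF \<mu>(2) refl] by blast
  have f\<nu>: "?f \<in> \<nu> \<rightarrow>\<^sub>M ?W'" using f measurable_cong_sets[OF \<nu> refl] by blast
  have sp: "space \<mu> = space ?W" "space \<nu> = space ?W"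
    using \<mu>(2) \<nu> by (auto dest: sets_eq_imp_space_eq)
  have "distr \<mu> ?W' ?f = distr \<nu> ?W' ?f"
  proof (rule measure_eqI_generator_eq[OF Int_stable_pair_measure_generator pair_measure_closed,
        where A="\<lambda>_. space (X \<Otimes>\<^sub>M Y) \<times> space Z"])
    fix R assume "R \<in> {a \<times> b |a b. a \<in> sets (X \<Otimes>\<^sub>M Y) \<and> b \<in> sets Z}"
    then obtain D E where R: "R = D \<times> E" and D: "D \<in> sets (X \<Otimes>\<^sub>M Y)" and E: "E \<in> sets Z" by blast
    have R': "R \<in> sets ?W'" unfolding R using D E by (rule pair_measureI)
    have "?f -` R \<inter> space ?W = {p\<in>space ?W. (fst p, fst (snd p)) \<in> D \<and> snd (snd p) \<in> E}"
      unfolding R by auto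
    then show "emeasure (distr \<mu> ?W' ?f) R = emeasure (distr \<nu> ?W' ?f) R"
      using eq[OF D E] by (simp add: emeasure_distr[OF f\<mu> R'] emeasure_distr[OF f\<nu> R'] sp)
  next
    interpret finite_measure \<mu> by fact
    interpret d: finite_measure "distr \<mu> ?W' ?f" by (rule finite_measure_distr[OF f\<mu>])
    show "emeasure (distr \<mu> ?W' ?f) (space (X \<Otimes>\<^sub>M Y) \<times> space Z) \<noteq> \<infinity>" for i :: nat
      using d.emeasure_finite by simp
    show "range (\<lambda>_::nat. space (X \<Otimes>\<^sub>M Y) \<times> space Z)
        \<subseteq> {a \<times> b |a b. a \<in> sets (X \<Otimes>\<^sub>M Y) \<and> b \<in> sets Z}"
      using sets.top by blast
  qed (simp_all only: sets_distr sets_pair_measure[of "X \<Otimes>\<^sub>M Y" Z] UN_constant, simp)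
  then have eq': "distr (distr \<mu> ?W' ?f) ?W ?g = distr (distr \<nu> ?W' ?f) ?W ?g" by simp
  \<comment> \<open>The two rebracketing maps are inverse to each other, so nothing is lost on the
    way.\<close>
  have distr_id: "distr (distr \<kappa> ?W' ?f) ?W ?g = \<kappa>" if "?f \<in> \<kappa> \<rightarrow>\<^sub>M ?W'" "sets \<kappa> = sets ?W" for \<kappa>
  proof -
    have "distr (distr \<kappa> ?W' ?f) ?W ?g = distr \<kappa> ?W (\<lambda>p. p)"
      by (subst distr_distr[OF g that(1)]) (simp add: comp_def)
    also have "\<dots> = distr \<kappa> \<kappa> (\<lambda>p. p)" by (rule distr_cong) (use that in auto)
    finally show ?thesis by simp
  qed
  show ?thesis using eq' unfolding distr_id[OF f\<mu> \<mu>(2)] distr_id[OF f\<nu> \<nu>] .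
qed

text \<open>The identity is measurable in both directions. The purpose is to recognise the
  sigma-algebra of action-state pairs as that of a Borel subset of a second countable space, to
  which the results on Borel versions apply.\<close>

lemma sets_pair_restrict_space:
  fixes X :: "'x measure" and Y :: "'y measure"
  shows   "sets (restrict_space X C \<Otimes>\<^sub>M restrict_space Y D) = sets (restrict_space (X \<Otimes>\<^sub>M Y) (C \<times> D))"
    (is "sets ?P = sets ?R")
proof -
  have sp: "space ?P = space ?R" by (auto simp: space_pair_measure space_restrict_space)
  have 1: "(\<lambda>p. p) \<in> ?R \<rightarrow>\<^sub>M ?P"
  proof -
    have "fst \<in> ?R \<rightarrow>\<^sub>M restrict_space X C" "snd \<in> ?R \<rightarrow>\<^sub>M restrict_space Y D"
      by (auto intro!: measurable_restrict_space3)
    from measurable_Pair[OF this] show ?thesis by simp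
  qed
  have 2: "(\<lambda>p. p) \<in> ?P \<rightarrow>\<^sub>M ?R"
  proof (rule measurable_restrict_space2)
    show "(\<lambda>p. p) \<in> space ?P \<rightarrow> C \<times> D" by (auto simp: space_pair_measure space_restrict_space)
    have "(\<lambda>x. x) \<in> restrict_space N E \<rightarrow>\<^sub>M N" for N :: "'x measure" and E
      by (rule measurable_restrict_space1) simp
    moreover have "(\<lambda>x. x) \<in> restrict_space N E \<rightarrow>\<^sub>M N" for N :: "'y measure" and E
      by (rule measurable_restrict_space1) simp
    ultimately have "(\<lambda>p. (fst p, snd p)) \<in> ?P \<rightarrow>\<^sub>M X \<Otimes>\<^sub>M Y"
      by (intro measurable_Pair measurable_compose[OF measurable_fst] measurable_compose[OF measurable_snd])
    then show "(\<lambda>p. p) \<in> ?P \<rightarrow>\<^sub>M X \<Otimes>\<^sub>M Y" by simp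
  qed
  show ?thesis
  proof
    show "sets ?P \<subseteq> sets ?R"
      using measurable_sets[OF 1] sp sets.Int_space_eq2[of _ ?P] by fastforce
    show "sets ?R \<subseteq> sets ?P"
      using measurable_sets[OF 2] sp sets.Int_space_eq2[of _ ?R] by fastforce
  qed
qed

locale ddp_theory =
  fixes M :: "('s::polish_space, 'a::polish_space) ddp"
  assumes model: "ddp_model M"
begin

abbreviation AS :: "('a \<times> 's) measure" where "AS \<equiv> AB M \<Otimes>\<^sub>M SB M"

section \<open>Sigma-algebras of states, actions and histories\<close>

lemma space_SB [simp]: "space (SB M) = states M"
  by (simp add: SB_def space_restrict_space)

lemma space_AB [simp]: "space (AB M) = actions M"
  by (simp add: AB_def space_restrict_space)

lemma sets_AS: "sets AS = sets (restrict_space borel (actions M \<times> states M))"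
  unfolding SB_def AB_def
  by (subst borel_prod[symmetric], rule sets_pair_restrict_space)

lemma borel_AS: "actions M \<times> states M \<in> sets borel"
  using model unfolding borel_prod[symmetric] ddp_model_def by auto

lemma space_Hist_memD:
  assumes "h \<in> space (Hist M t)"
  shows "fst h \<in> states M" "state t h \<in> states M"
  using assms by (auto simp: Hist_def space_pair_measure space_PiM state_def PiE_def Pi_def split: nat.splits)

lemma measurable_hist [measurable]: "hist t \<in> Hinf M \<rightarrow>\<^sub>M Hist M t"
  unfolding hist_def[abs_def] Hinf_def Hist_def
  by (intro measurable_Pair measurable_fst measurable_compose[OF measurable_snd]
      measurable_restrict_subset) auto

lemma measurable_state [measurable]: "state t \<in> Hist M t \<rightarrow>\<^sub>M SB M"
proof (cases t)
  case 0
  have "state t = (fst :: ('s, 'a) history \<Rightarrow> 's)" by (auto simp: 0)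
  then show ?thesis unfolding Hist_def by (simp only: measurable_fst)
next
  case (Suc i)
  have "state t = (\<lambda>h :: ('s, 'a) history. snd (snd h i))" by (auto simp: Suc state_Suc)
  moreover have "(\<lambda>h. snd (snd h i)) \<in> Hist M t \<rightarrow>\<^sub>M SB M"
    unfolding Hist_def
    by (rule measurable_compose[OF _ measurable_snd], rule measurable_compose[OF measurable_snd],
        rule measurable_component_singleton) (simp add: Suc)
  ultimately show ?thesis by simp
qed

lemma measurable_step [measurable]: "(\<lambda>\<omega>. snd \<omega> t) \<in> Hinf M \<rightarrow>\<^sub>M AS"
  unfolding Hinf_def
  by (rule measurable_compose[OF measurable_snd], rule measurable_component_singleton) simp

lemma measurable_act [measurable]: "act t \<in> Hinf M \<rightarrow>\<^sub>M AB M"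
  unfolding act_def[abs_def] by measurable

lemma measurable_state_Hinf [measurable]: "state t \<in> Hinf M \<rightarrow>\<^sub>M SB M"
  using measurable_compose[OF measurable_hist measurable_state, of t] by simp

lemma measurable_ext [measurable]: "ext t \<in> Hist M t \<Otimes>\<^sub>M AS \<rightarrow>\<^sub>M Hist M (Suc t)"
proof -
  have "(\<lambda>p. (snd (fst p))(t := snd p)) \<in> Hist M t \<Otimes>\<^sub>M AS \<rightarrow>\<^sub>M PiM {..<Suc t} (\<lambda>_. AS)"
    by (rule measurable_fun_upd[where J="{..<t}"]) (auto simp: Hist_def)
  moreover have "(\<lambda>p. fst (fst p)) \<in> Hist M t \<Otimes>\<^sub>M AS \<rightarrow>\<^sub>M SB M"
    by (auto simp: Hist_def)
  ultimately show ?thesis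
    unfolding ext_def[abs_def] Hist_def by (intro measurable_Pair)
qed

section \<open>Transitions and strategies as generalised measurable kernels\<close>

lemma discount: "0 < discount M" "discount M < 1"
  using model by (auto simp: ddp_model_def)

lemma trans_prob:
  assumes "s \<in> states M" "a \<in> actions M"
  shows "prob_space (trans M s a)" "sets (trans M s a) = sets (SB M)" "space (trans M s a) = states M"
proof -
  show "prob_space (trans M s a)" and *: "sets (trans M s a) = sets (SB M)"
    using assms model by (auto simp: ddp_model_def)
  show "space (trans M s a) = states M" using sets_eq_imp_space_eq[OF *] by simp
qed

text \<open>The model gives measurability of the mass of each fixed Borel set. The full
  sigma-algebra is an intersection-stable generator of itself, so this amounts to measurability into
  the space of probability measures.\<close>

lemma trans_kernel: "(\<lambda>p. trans M (fst p) (snd p)) \<in> UM (mode M) (SB M \<Otimes>\<^sub>M AB M) \<rightarrow>\<^sub>M prob_algebra (SB M)"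
proof (rule measurable_prob_algebra_generated)
  show "sets (SB M) = sigma_sets (space (SB M)) (sets (SB M))"
    by (rule sets.sigma_sets_eq[symmetric])
  show "Int_stable (sets (SB M))" by (rule sets.Int_stable)
  show "sets (SB M) \<subseteq> Pow (space (SB M))" by (rule sets.space_closed)
  fix p assume "p \<in> space (UM (mode M) (SB M \<Otimes>\<^sub>M AB M))"
  then have p: "fst p \<in> states M" "snd p \<in> actions M" by (auto simp: space_pair_measure)
  show "prob_space (trans M (fst p) (snd p))" "sets (trans M (fst p) (snd p)) = sets (SB M)"
    using trans_prob[OF p] by auto
next
  fix B assume B: "B \<in> sets (SB M)"
  have "(\<lambda>(s, a). measure (trans M s a) B) \<in> UM (mode M) (SB M \<Otimes>\<^sub>M AB M) \<rightarrow>\<^sub>M borel"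
    using model B unfolding ddp_model_def umeas_eq_measurable by blast
  then have "(\<lambda>p. ennreal (measure (trans M (fst p) (snd p)) B)) \<in> UM (mode M) (SB M \<Otimes>\<^sub>M AB M) \<rightarrow>\<^sub>M borel"
    by (simp add: case_prod_beta')
  then show "(\<lambda>p. emeasure (trans M (fst p) (snd p)) B) \<in> UM (mode M) (SB M \<Otimes>\<^sub>M AB M) \<rightarrow>\<^sub>M borel"
  proof (rule measurable_cong[THEN iffD1, rotated])
    fix p assume "p \<in> space (UM (mode M) (SB M \<Otimes>\<^sub>M AB M))"
    then have "fst p \<in> states M" "snd p \<in> actions M" by (auto simp: space_pair_measure)
    then interpret prob_space "trans M (fst p) (snd p)" by (rule trans_prob)
    show "ennreal (prob B) = emeasure (trans M (fst p) (snd p)) B"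
      by (rule emeasure_eq_measure[symmetric])
  qed
qed

lemma strategiesD:
  assumes "\<sigma> \<in> strategies M"
  shows "\<sigma> t \<in> UM (mode M) (Hist M t) \<rightarrow>\<^sub>M AB M"
    and "h \<in> space (Hist M t) \<Longrightarrow> \<sigma> t h \<in> \<Gamma> M (state t h)"
    and "h \<in> space (Hist M t) \<Longrightarrow> \<sigma> t h \<in> actions M"
  using assms by (auto simp: strategies_def umeas_eq_measurable \<Gamma>_def)

lemma state_action_UM:
  assumes "\<sigma> \<in> strategies M"
  shows "(\<lambda>h. (state t h, \<sigma> t h)) \<in> UM (mode M) (Hist M t) \<rightarrow>\<^sub>M SB M \<Otimes>\<^sub>M AB M"
  by (intro measurable_Pair measurable_UM measurable_state strategiesD assms)

text \<open>The law, given the history, of the entry with index \<open>t\<close>: the Dirac measure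
  at the chosen action times the transition law. Since strategy and transition sit in one kernel, a
  single Borel version takes care of both.\<close>

definition step_kernel :: "('s, 'a) strategy \<Rightarrow> nat \<Rightarrow> ('s, 'a) history \<Rightarrow> ('a \<times> 's) measure" where
  "step_kernel \<sigma> t h = distr (trans M (state t h) (\<sigma> t h)) AS (Pair (\<sigma> t h))"

lemma step_kernel_UM:
  assumes \<sigma>: "\<sigma> \<in> strategies M"
  shows "step_kernel \<sigma> t \<in> UM (mode M) (Hist M t) \<rightarrow>\<^sub>M prob_algebra AS"
  unfolding step_kernel_def[abs_def]
proof (rule measurable_distr_prob_space2)
  show "(\<lambda>h. trans M (state t h) (\<sigma> t h)) \<in> UM (mode M) (Hist M t) \<rightarrow>\<^sub>M prob_algebra (SB M)"
    using UM_compose[OF state_action_UM[OF \<sigma>] trans_kernel] by simp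
  show "(\<lambda>(h, s'). (\<sigma> t h, s')) \<in> UM (mode M) (Hist M t) \<Otimes>\<^sub>M SB M \<rightarrow>\<^sub>M AS"
    unfolding case_prod_beta'
    by (intro measurable_Pair measurable_snd measurable_compose[OF measurable_fst] strategiesD \<sigma>)
qed

end

section \<open>Induced measures and disintegrations\<close>

context ddp_theory
begin

section \<open>Laws of finite histories and semidirect products\<close>

definition marg :: "('s, 'a) history measure \<Rightarrow> nat \<Rightarrow> ('s, 'a) history measure" where
  "marg P t = distr P (Hist M t) (hist t)"

definition joint :: "('s, 'a) history measure \<Rightarrow> nat \<Rightarrow> (('s, 'a) history \<times> 'a \<times> 's) measure" where
  "joint P t = distr P (Hist M t \<Otimes>\<^sub>M AS) (\<lambda>\<omega>. (hist t \<omega>, snd \<omega> t))"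

text \<open>The semidirect product of \<open>\<mu>\<close> and \<open>K\<close>. The equation
  \<open>joint P t = extend t K (marg P t)\<close> says that \<open>K\<close> is a regular
  conditional law of the entry with index \<open>t\<close> given the history before it.\<close>

definition extend :: "nat \<Rightarrow> (('s, 'a) history \<Rightarrow> ('a \<times> 's) measure) \<Rightarrow>
    ('s, 'a) history measure \<Rightarrow> (('s, 'a) history \<times> 'a \<times> 's) measure" where
  "extend t K \<mu> = \<mu> \<bind> (\<lambda>h. distr (K h) (Hist M t \<Otimes>\<^sub>M AS) (Pair h))"

lemma sets_marg [simp]: "sets (marg P t) = sets (Hist M t)"
  and space_marg [simp]: "space (marg P t) = space (Hist M t)"
  and sets_joint [simp]: "sets (joint P t) = sets (Hist M t \<Otimes>\<^sub>M AS)"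
  by (simp_all add: marg_def joint_def)

lemma measurable_Hinf_cong: "sets P = sets (Hinf M) \<Longrightarrow> f \<in> Hinf M \<rightarrow>\<^sub>M N \<Longrightarrow> f \<in> P \<rightarrow>\<^sub>M N"
  using measurable_cong_sets[of P "Hinf M" N N] by blast

lemma measurable_joint [measurable]: "(\<lambda>\<omega>. (hist t \<omega>, snd \<omega> t)) \<in> Hinf M \<rightarrow>\<^sub>M Hist M t \<Otimes>\<^sub>M AS"
  by measurable

lemma marg_prob:
  assumes "prob_space P" "sets P = sets (Hinf M)"
  shows "prob_space (marg P t)" "marg P t \<in> space (prob_algebra (Hist M t))"
proof -
  show "prob_space (marg P t)"
    unfolding marg_def
    by (rule prob_space.prob_space_distr[OF assms(1) measurable_Hinf_cong[OF assms(2) measurable_hist]])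
  then show "marg P t \<in> space (prob_algebra (Hist M t))" by (simp add: space_prob_algebra)
qed

lemma marg_Suc:
  assumes "sets P = sets (Hinf M)"
  shows "marg P (Suc t) = distr (joint P t) (Hist M (Suc t)) (ext t)"
  unfolding marg_def joint_def
  by (subst distr_distr[OF measurable_ext measurable_Hinf_cong[OF assms measurable_joint]])
     (simp add: comp_def hist_Suc[symmetric])

lemma measurable_kernel_Pair:
  assumes "K \<in> Hist M t \<rightarrow>\<^sub>M prob_algebra AS"
  shows "(\<lambda>h. distr (K h) (Hist M t \<Otimes>\<^sub>M AS) (Pair h)) \<in> Hist M t \<rightarrow>\<^sub>M prob_algebra (Hist M t \<Otimes>\<^sub>M AS)"
  by (rule measurable_distr_prob_space2[OF assms]) simp

lemma sets_extend:
  assumes "\<mu> \<in> space (prob_algebra (Hist M t))" "K \<in> Hist M t \<rightarrow>\<^sub>M prob_algebra AS"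
  shows "sets (extend t K \<mu>) = sets (Hist M t \<Otimes>\<^sub>M AS)" "prob_space (extend t K \<mu>)"
  unfolding extend_def
  using sets_bind'[OF assms(1) measurable_kernel_Pair[OF assms(2)]]
    prob_space_bind'[OF assms(1) measurable_kernel_Pair[OF assms(2)]] by auto

lemma kernel_memD:
  assumes "K \<in> Hist M t \<rightarrow>\<^sub>M prob_algebra AS" "h \<in> space (Hist M t)"
  shows "prob_space (K h)" "sets (K h) = sets AS" "space (K h) = actions M \<times> states M"
    "Pair h \<in> K h \<rightarrow>\<^sub>M Hist M t \<Otimes>\<^sub>M AS"
proof -
  show 1: "prob_space (K h)" "sets (K h) = sets AS"
    using measurable_space[OF assms] by (auto simp: space_prob_algebra)
  show "space (K h) = actions M \<times> states M"
    using sets_eq_imp_space_eq[OF 1(2)] by (simp add: space_pair_measure)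
  show "Pair h \<in> K h \<rightarrow>\<^sub>M Hist M t \<Otimes>\<^sub>M AS"
    using measurable_Pair1'[OF assms(2), of AS] measurable_cong_sets[OF 1(2) refl] by blast
qed

lemma nn_integral_extend:
  assumes \<mu>: "\<mu> \<in> space (prob_algebra (Hist M t))" and K: "K \<in> Hist M t \<rightarrow>\<^sub>M prob_algebra AS"
    and f: "f \<in> borel_measurable (Hist M t \<Otimes>\<^sub>M AS)"
  shows "(\<integral>\<^sup>+ p. f p \<partial>extend t K \<mu>) = (\<integral>\<^sup>+ h. \<integral>\<^sup>+ y. f (h, y) \<partial>K h \<partial>\<mu>)"
proof -
  have s: "sets \<mu> = sets (Hist M t)" using \<mu> by (simp add: space_prob_algebra)
  have sp: "space \<mu> = space (Hist M t)" by (rule sets_eq_imp_space_eq[OF s])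
  have "(\<lambda>h. distr (K h) (Hist M t \<Otimes>\<^sub>M AS) (Pair h)) \<in> \<mu> \<rightarrow>\<^sub>M subprob_algebra (Hist M t \<Otimes>\<^sub>M AS)"
    using measurable_prob_algebraD[OF measurable_kernel_Pair[OF K]] measurable_cong_sets[OF s refl] by blast
  then have "(\<integral>\<^sup>+ p. f p \<partial>extend t K \<mu>) =
      (\<integral>\<^sup>+ h. \<integral>\<^sup>+ p. f p \<partial>distr (K h) (Hist M t \<Otimes>\<^sub>M AS) (Pair h) \<partial>\<mu>)"
    unfolding extend_def by (rule nn_integral_bind[OF f])
  also have "\<dots> = (\<integral>\<^sup>+ h. \<integral>\<^sup>+ y. f (h, y) \<partial>K h \<partial>\<mu>)"
    by (intro nn_integral_cong nn_integral_distr kernel_memD(4)[OF K]) (simp_all add: sp f)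
  finally show ?thesis .
qed

text \<open>A rectangle for the splitting into (history, action) and next state, written inside the
  product that splits into history and (action, next state).\<close>

definition rect :: "nat \<Rightarrow> (('s, 'a) history \<times> 'a) set \<Rightarrow> 's set \<Rightarrow> (('s, 'a) history \<times> 'a \<times> 's) set" where
  "rect t D B = {p\<in>space (Hist M t \<Otimes>\<^sub>M AS). (fst p, fst (snd p)) \<in> D \<and> snd (snd p) \<in> B}"

lemma rect_sets [measurable]:
  assumes [measurable]: "D \<in> sets (Hist M t \<Otimes>\<^sub>M AB M)" "B \<in> sets (SB M)"
  shows "rect t D B \<in> sets (Hist M t \<Otimes>\<^sub>M AS)"
  unfolding rect_def by measurable

lemma emeasure_joint_rect:
  assumes P: "sets P = sets (Hinf M)" and D: "D \<in> sets (Hist M t \<Otimes>\<^sub>M AB M)" "B \<in> sets (SB M)"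
  shows "emeasure (joint P t) (rect t D B) =
    emeasure P {\<omega>\<in>space P. (hist t \<omega>, act t \<omega>) \<in> D \<and> state (Suc t) \<omega> \<in> B}"
proof -
  have m: "(\<lambda>\<omega>. (hist t \<omega>, snd \<omega> t)) \<in> P \<rightarrow>\<^sub>M Hist M t \<Otimes>\<^sub>M AS"
    by (rule measurable_Hinf_cong[OF P measurable_joint])
  have "(\<lambda>\<omega>. (hist t \<omega>, snd \<omega> t)) -` rect t D B \<inter> space P =
      {\<omega>\<in>space P. (hist t \<omega>, act t \<omega>) \<in> D \<and> state (Suc t) \<omega> \<in> B}"
    using measurable_space[OF m] by (auto simp: rect_def act_def state_Suc)
  then show ?thesis
    unfolding joint_def by (simp add: emeasure_distr[OF m] rect_sets[OF D])
qed

text \<open>\<open>P\<close> is assumed only to follow the strategy at date \<open>t\<close>, not to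
  have the right conditional law. The equivalence proved here is used in both directions: to
  disintegrate a given induced measure, and to show that a constructed measure is induced.\<close>

context
  fixes \<sigma> P t K
  assumes \<sigma>: "\<sigma> \<in> strategies M" and P: "prob_space P" "sets P = sets (Hinf M)"
    and act: "AE \<omega> in P. act t \<omega> = \<sigma> t (hist t \<omega>)"
    and K: "K \<in> Hist M t \<rightarrow>\<^sub>M prob_algebra AS"
    and Kker: "AE h in marg P t. K h = step_kernel \<sigma> t h"
begin

interpretation prob_space P by (rule P(1))

lemma hist_P: "hist t \<in> P \<rightarrow>\<^sub>M Hist M t"
  by (rule measurable_Hinf_cong[OF P(2) measurable_hist])

lemma AE_kernel: "AE \<omega> in P. K (hist t \<omega>) = step_kernel \<sigma> t (hist t \<omega>)"
  using AE_distrD[OF hist_P Kker[unfolded marg_def]] .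

text \<open>The action component of the step kernel is deterministic, so the section of a rectangle
  is charged only if the history and the prescribed action lie in \<open>D\<close>, and then with
  the transition mass of \<open>B\<close>.\<close>

lemma measure_kernel_rect:
  assumes h: "h \<in> space (Hist M t)" and B: "B \<in> sets (SB M)"
  shows "measure (step_kernel \<sigma> t h) (actions M \<times> B) = measure (trans M (state t h) (\<sigma> t h)) B"
    and "D \<in> sets (Hist M t \<Otimes>\<^sub>M AB M) \<Longrightarrow>
      emeasure (step_kernel \<sigma> t h) (Pair h -` rect t D B) =
      indicator D (h, \<sigma> t h) * ennreal (measure (trans M (state t h) (\<sigma> t h)) B)"
proof -
  have a: "\<sigma> t h \<in> actions M" and s: "state t h \<in> states M"
    using strategiesD[OF \<sigma>] h space_Hist_memD by auto
  interpret T: prob_space "trans M (state t h) (\<sigma> t h)" by (rule trans_prob[OF s a])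
  have m: "Pair (\<sigma> t h) \<in> trans M (state t h) (\<sigma> t h) \<rightarrow>\<^sub>M AS"
  proof -
    have "Pair (\<sigma> t h) \<in> SB M \<rightarrow>\<^sub>M AS" by (rule measurable_Pair1') (simp add: a)
    then show ?thesis using measurable_cong_sets[OF trans_prob(2)[OF s a] refl] by blast
  qed
  have sp: "space (trans M (state t h) (\<sigma> t h)) = states M" by (rule trans_prob(3)[OF s a])
  have BS: "B \<subseteq> states M" using sets.sets_into_space[OF B] by simp
  have "actions M \<times> B \<in> sets AS"
    using pair_measureI[OF sets.top[of "AB M"] B] by simp
  then show "measure (step_kernel \<sigma> t h) (actions M \<times> B) = measure (trans M (state t h) (\<sigma> t h)) B"
    unfolding step_kernel_def by (simp add: measure_distr[OF m] sp a Int_absorb2[OF BS])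
  assume D: "D \<in> sets (Hist M t \<Otimes>\<^sub>M AB M)"
  have "Pair h -` rect t D B \<in> sets AS"
    by (rule sets_Pair1[OF rect_sets[OF D B]])
  then have "emeasure (step_kernel \<sigma> t h) (Pair h -` rect t D B) =
      emeasure (trans M (state t h) (\<sigma> t h)) (Pair (\<sigma> t h) -` (Pair h -` rect t D B) \<inter> states M)"
    unfolding step_kernel_def by (simp add: emeasure_distr[OF m] sp)
  also have "Pair (\<sigma> t h) -` (Pair h -` rect t D B) \<inter> states M = (if (h, \<sigma> t h) \<in> D then B else {})"
    using a h BS by (auto simp: rect_def space_pair_measure)
  finally show "emeasure (step_kernel \<sigma> t h) (Pair h -` rect t D B) =
      indicator D (h, \<sigma> t h) * ennreal (measure (trans M (state t h) (\<sigma> t h)) B)"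
    by (auto simp: T.emeasure_eq_measure)
qed

text \<open>The mass \<open>measure (K h) (actions M \<times> B)\<close> is a Borel version of the
  transition probability of \<open>B\<close>. Almost surely the action is the prescribed one, which
  turns the condition on the prescribed action into one on \<open>act t\<close>.\<close>

lemma emeasure_extend_rect:
  assumes D: "D \<in> sets (Hist M t \<Otimes>\<^sub>M AB M)" and B: "B \<in> sets (SB M)"
  shows "emeasure (extend t K (marg P t)) (rect t D B) =
    (\<integral>\<^sup>+ \<omega>. indicator D (hist t \<omega>, act t \<omega>) * ennreal (measure (K (hist t \<omega>)) (actions M \<times> B)) \<partial>P)"
proof -
  let ?R = "rect t D B"
  have R: "?R \<in> sets (Hist M t \<Otimes>\<^sub>M AS)" by (rule rect_sets[OF D B])
  have "emeasure (extend t K (marg P t)) ?R = (\<integral>\<^sup>+ p. indicator ?R p \<partial>extend t K (marg P t))"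
    using sets_extend[OF marg_prob(2)[OF P] K] R by simp
  also have "\<dots> = (\<integral>\<^sup>+ h. \<integral>\<^sup>+ y. indicator ?R (h, y) \<partial>K h \<partial>marg P t)"
    by (rule nn_integral_extend[OF marg_prob(2)[OF P] K]) (use R in simp)
  also have "\<dots> = (\<integral>\<^sup>+ h. emeasure (K h) (Pair h -` ?R) \<partial>marg P t)"
  proof (rule nn_integral_cong)
    fix h assume "h \<in> space (marg P t)"
    then have h: "h \<in> space (Hist M t)" by simp
    have "Pair h -` ?R \<in> sets (K h)"
      unfolding kernel_memD(2)[OF K h] by (rule sets_Pair1[OF R])
    moreover have "indicator ?R (h, y) = (indicator (Pair h -` ?R) y :: ennreal)" for y
      by (auto split: split_indicator)
    ultimately show "(\<integral>\<^sup>+ y. indicator ?R (h, y) \<partial>K h) = emeasure (K h) (Pair h -` ?R)" by simp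
  qed
  also have "\<dots> = (\<integral>\<^sup>+ \<omega>. emeasure (K (hist t \<omega>)) (Pair (hist t \<omega>) -` ?R) \<partial>P)"
    unfolding marg_def
  proof (rule nn_integral_distr[OF hist_P])
    have "(\<lambda>h. emeasure (K h) (Pair h -` ?R)) \<in> borel_measurable (Hist M t)"
    proof (rule emeasure_measurable_subprob_algebra2[OF _ measurable_prob_algebraD[OF K]])
      have "(SIGMA h:space (Hist M t). Pair h -` ?R) = ?R"
        by (auto simp: rect_def space_pair_measure)
      then show "(SIGMA h:space (Hist M t). Pair h -` ?R) \<in> sets (Hist M t \<Otimes>\<^sub>M AS)" using R by simp
    qed
    then show "(\<lambda>h. emeasure (K h) (Pair h -` ?R)) \<in> borel_measurable (distr P (Hist M t) (hist t))"
      by simp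
  qed
  also have "\<dots> = (\<integral>\<^sup>+ \<omega>. indicator D (hist t \<omega>, act t \<omega>) *
      ennreal (measure (K (hist t \<omega>)) (actions M \<times> B)) \<partial>P)"
  proof (rule nn_integral_cong_AE)
    show "AE \<omega> in P. emeasure (K (hist t \<omega>)) (Pair (hist t \<omega>) -` ?R) =
        indicator D (hist t \<omega>, act t \<omega>) * ennreal (measure (K (hist t \<omega>)) (actions M \<times> B))"
      using AE_space AE_kernel act
    proof eventually_elim
      case (elim \<omega>)
      have h: "hist t \<omega> \<in> space (Hist M t)" using measurable_space[OF hist_P elim(1)] .
      show ?case
        unfolding elim measure_kernel_rect(1)[OF h B] measure_kernel_rect(2)[OF h B D] ..
    qed
  qed
  finally show ?thesis .
qed

lemma joint_eq_extend_iff: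
  "joint P t = extend t K (marg P t) \<longleftrightarrow>
    (\<forall>D\<in>sets (Hist M t \<Otimes>\<^sub>M AB M). \<forall>B\<in>sets (SB M).
      emeasure P {\<omega>\<in>space P. (hist t \<omega>, act t \<omega>) \<in> D \<and> state (Suc t) \<omega> \<in> B} =
      (\<integral>\<^sup>+ \<omega>. indicator D (hist t \<omega>, act t \<omega>) * ennreal (measure (K (hist t \<omega>)) (actions M \<times> B)) \<partial>P))"
  (is "_ \<longleftrightarrow> ?rhs")
proof
  assume eq: "joint P t = extend t K (marg P t)"
  show ?rhs
  proof (intro ballI)
    fix D B assume D: "D \<in> sets (Hist M t \<Otimes>\<^sub>M AB M)" "B \<in> sets (SB M)"
    show "emeasure P {\<omega>\<in>space P. (hist t \<omega>, act t \<omega>) \<in> D \<and> state (Suc t) \<omega> \<in> B} =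
      (\<integral>\<^sup>+ \<omega>. indicator D (hist t \<omega>, act t \<omega>) * ennreal (measure (K (hist t \<omega>)) (actions M \<times> B)) \<partial>P)"
      unfolding emeasure_joint_rect[OF P(2) D, symmetric] eq by (rule emeasure_extend_rect[OF D])
  qed
next
  assume rhs: ?rhs
  have m: "(\<lambda>\<omega>. (hist t \<omega>, snd \<omega> t)) \<in> P \<rightarrow>\<^sub>M Hist M t \<Otimes>\<^sub>M AS"
    by (rule measurable_Hinf_cong[OF P(2) measurable_joint])
  show "joint P t = extend t K (marg P t)"
  proof (rule measure_eqI_assoc)
    show "finite_measure (joint P t)"
      unfolding joint_def by (rule finite_measure_distr[OF m])
    show "sets (extend t K (marg P t)) = sets (Hist M t \<Otimes>\<^sub>M AS)"
      by (rule sets_extend[OF marg_prob(2)[OF P] K])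
    fix D B assume "D \<in> sets (Hist M t \<Otimes>\<^sub>M AB M)" "B \<in> sets (SB M)"
    then have "emeasure (joint P t) (rect t D B) = emeasure (extend t K (marg P t)) (rect t D B)"
      using emeasure_joint_rect[OF P(2)] emeasure_extend_rect rhs by simp
    then show "emeasure (joint P t) {p\<in>space (Hist M t \<Otimes>\<^sub>M AS). (fst p, fst (snd p)) \<in> D \<and> snd (snd p) \<in> B} =
        emeasure (extend t K (marg P t)) {p\<in>space (Hist M t \<Otimes>\<^sub>M AS). (fst p, fst (snd p)) \<in> D \<and> snd (snd p) \<in> B}"
      unfolding rect_def .
  qed simp
qed

text \<open>Conditional expectations are characterised by integrals over the conditioning
  sigma-algebra, whose sets are the preimages of the sets \<open>D\<close>. These integrals are the
  two sides of the rectangle condition in \<open>joint_eq_extend_iff\<close>.\<close>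

lemma cond_exp_iff:
  "(\<forall>B\<in>sets (SB M). AE \<omega> in P.
      real_cond_exp P (vimage_algebra (space P) (\<lambda>\<omega>. (hist t \<omega>, act t \<omega>)) (Hist M t \<Otimes>\<^sub>M AB M))
        (indicator {\<omega>\<in>space P. state (Suc t) \<omega> \<in> B}) \<omega>
      = measure (trans M (state t \<omega>) (act t \<omega>)) B) \<longleftrightarrow>
    joint P t = extend t K (marg P t)"
proof -
  let ?F = "vimage_algebra (space P) (\<lambda>\<omega>. (hist t \<omega>, act t \<omega>)) (Hist M t \<Otimes>\<^sub>M AB M)"
  \<comment> \<open>The transition probability along the path need not be measurable for the
    conditioning sigma-algebra \<open>?F\<close>. Its version \<open>g B\<close> is, being a Borel
    function of the history, and may therefore serve as a conditional expectation.\<close>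
  define g where "g B \<omega> = measure (K (hist t \<omega>)) (actions M \<times> B)" for B \<omega>
  define E where "E B = {\<omega>\<in>space P. state (Suc t) \<omega> \<in> B}" for B
  have ha: "(\<lambda>\<omega>. (hist t \<omega>, act t \<omega>)) \<in> P \<rightarrow>\<^sub>M Hist M t \<Otimes>\<^sub>M AB M"
    by (rule measurable_Hinf_cong[OF P(2)]) measurable
  have st: "state (Suc t) \<in> P \<rightarrow>\<^sub>M SB M"
    by (rule measurable_Hinf_cong[OF P(2) measurable_state_Hinf])
  have ha': "(\<lambda>\<omega>. (hist t \<omega>, act t \<omega>)) \<in> space P \<rightarrow> space (Hist M t \<Otimes>\<^sub>M AB M)"
    using measurable_space[OF ha] by blast
  have sub: "subalgebra P ?F"
    unfolding subalgebra_def using ha ha'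
    by (auto simp: sets_vimage_algebra2 intro: measurable_sets)
  interpret F: finite_measure_subalgebra P ?F
    by unfold_locales (rule sub)
  have E: "E B \<in> sets P" if "B \<in> sets (SB M)" for B
  proof -
    have "E B = state (Suc t) -` B \<inter> space P" unfolding E_def by blast
    then show ?thesis using measurable_sets[OF st that] by simp
  qed
  have gF: "g B \<in> borel_measurable ?F" if B: "B \<in> sets (SB M)" for B
  proof -
    have AB: "actions M \<times> B \<in> sets AS"
      using pair_measureI[OF sets.top[of "AB M"] B] by simp
    have "(\<lambda>p. measure (K (fst p)) (actions M \<times> B)) \<in> borel_measurable (Hist M t \<Otimes>\<^sub>M AB M)"
      by (rule measurable_compose[OF measurable_fst])
         (rule measurable_compose[OF K measurable_measure_prob_algebra[OF AB]])
    from measurable_compose[OF measurable_vimage_algebra1[OF ha'] this]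
    show ?thesis by (simp add: g_def[abs_def])
  qed
  have gP: "g B \<in> borel_measurable P" if "B \<in> sets (SB M)" for B
    by (rule measurable_from_subalg[OF sub gF[OF that]])
  have g01: "0 \<le> g B \<omega>" "g B \<omega> \<le> 1" if "\<omega> \<in> space P" for B \<omega>
  proof -
    interpret K: prob_space "K (hist t \<omega>)"
      by (rule kernel_memD(1)[OF K]) (rule measurable_space[OF hist_P that])
    show "0 \<le> g B \<omega>" "g B \<omega> \<le> 1" unfolding g_def by auto
  qed
  have gint: "integrable P (g B)" if "B \<in> sets (SB M)" for B
    by (rule integrable_const_bound[of _ 1, OF _ gP[OF that]]) (use g01 in auto)
  have Eint: "integrable P (indicator (E B) :: _ \<Rightarrow> real)" if "B \<in> sets (SB M)" for B
    using E[OF that] by (simp add: emeasure_eq_measure)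
  have gAE: "AE \<omega> in P. measure (trans M (state t \<omega>) (act t \<omega>)) B = g B \<omega>" if B: "B \<in> sets (SB M)" for B
    using AE_space AE_kernel act
  proof eventually_elim
    case (elim \<omega>)
    have h: "hist t \<omega> \<in> space (Hist M t)" using measurable_space[OF hist_P elim(1)] .
    show ?case
      unfolding g_def elim using measure_kernel_rect(1)[OF h B] by simp
  qed
  have F_sets: "sets ?F = {(\<lambda>\<omega>. (hist t \<omega>, act t \<omega>)) -` D \<inter> space P | D. D \<in> sets (Hist M t \<Otimes>\<^sub>M AB M)}"
    by (rule sets_vimage_algebra2[OF ha'])
  \<comment> \<open>This passes between the set integrals that characterise conditional expectations
    and the nonnegative integrals that occur in the rectangle condition.\<close>
  have key: "(\<integral>\<omega>\<in>(\<lambda>\<omega>. (hist t \<omega>, act t \<omega>)) -` D \<inter> space P. indicator (E B) \<omega> \<partial>P) =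
        (\<integral>\<omega>\<in>(\<lambda>\<omega>. (hist t \<omega>, act t \<omega>)) -` D \<inter> space P. g B \<omega> \<partial>P) \<longleftrightarrow>
      emeasure P {\<omega>\<in>space P. (hist t \<omega>, act t \<omega>) \<in> D \<and> state (Suc t) \<omega> \<in> B} =
        (\<integral>\<^sup>+ \<omega>. indicator D (hist t \<omega>, act t \<omega>) * ennreal (measure (K (hist t \<omega>)) (actions M \<times> B)) \<partial>P)"
    if D: "D \<in> sets (Hist M t \<Otimes>\<^sub>M AB M)" and B: "B \<in> sets (SB M)" for D B
  proof -
    let ?A = "(\<lambda>\<omega>. (hist t \<omega>, act t \<omega>)) -` D \<inter> space P"
    have A: "?A \<in> sets P" by (rule measurable_sets[OF ha D])
    have AE': "?A \<inter> E B = {\<omega>\<in>space P. (hist t \<omega>, act t \<omega>) \<in> D \<and> state (Suc t) \<omega> \<in> B}"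
      unfolding E_def by blast
    have "(\<integral>\<omega>\<in>?A. indicator (E B) \<omega> \<partial>P) = (\<integral>\<omega>. indicator (?A \<inter> E B) \<omega> \<partial>P)"
      unfolding set_lebesgue_integral_def
      by (rule Bochner_Integration.integral_cong) (auto split: split_indicator)
    also have "\<dots> = measure P (?A \<inter> E B)" using A E[OF B] by simp
    finally have 1: "(\<integral>\<omega>\<in>?A. indicator (E B) \<omega> \<partial>P) = measure P (?A \<inter> E B)" .
    have "(\<integral>\<^sup>+ \<omega>. indicator D (hist t \<omega>, act t \<omega>) * ennreal (measure (K (hist t \<omega>)) (actions M \<times> B)) \<partial>P) =
        (\<integral>\<^sup>+ \<omega>. ennreal (indicator ?A \<omega> * g B \<omega>) \<partial>P)"
      by (rule nn_integral_cong) (auto simp: g_def split: split_indicator)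
    also have "\<dots> = ennreal (\<integral>\<omega>. indicator ?A \<omega> * g B \<omega> \<partial>P)"
      by (rule nn_integral_eq_integral)
         (use integrable_mult_indicator[OF A gint[OF B]] g01 in \<open>auto intro!: AE_I2\<close>)
    finally have 2: "(\<integral>\<^sup>+ \<omega>. indicator D (hist t \<omega>, act t \<omega>) * ennreal (measure (K (hist t \<omega>)) (actions M \<times> B)) \<partial>P) =
        ennreal (\<integral>\<omega>\<in>?A. g B \<omega> \<partial>P)"
      unfolding set_lebesgue_integral_def by simp
    have 3: "0 \<le> (\<integral>\<omega>\<in>?A. g B \<omega> \<partial>P)"
      unfolding set_lebesgue_integral_def
      by (rule integral_nonneg_AE) (use g01 in \<open>auto intro!: AE_I2\<close>)
    show ?thesis
      unfolding 1 2 AE'[symmetric] emeasure_eq_measure using 3 by simp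
  qed
  have iff: "(AE \<omega> in P. real_cond_exp P ?F (indicator (E B)) \<omega> = measure (trans M (state t \<omega>) (act t \<omega>)) B) \<longleftrightarrow>
      (\<forall>D\<in>sets (Hist M t \<Otimes>\<^sub>M AB M).
      emeasure P {\<omega>\<in>space P. (hist t \<omega>, act t \<omega>) \<in> D \<and> state (Suc t) \<omega> \<in> B} =
        (\<integral>\<^sup>+ \<omega>. indicator D (hist t \<omega>, act t \<omega>) * ennreal (measure (K (hist t \<omega>)) (actions M \<times> B)) \<partial>P))"
    if B: "B \<in> sets (SB M)" for B
  proof
    assume "AE \<omega> in P. real_cond_exp P ?F (indicator (E B)) \<omega> = measure (trans M (state t \<omega>) (act t \<omega>)) B"
    then have *: "AE \<omega> in P. real_cond_exp P ?F (indicator (E B)) \<omega> = g B \<omega>"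
      using gAE[OF B] by eventually_elim simp
    show "\<forall>D\<in>sets (Hist M t \<Otimes>\<^sub>M AB M).
      emeasure P {\<omega>\<in>space P. (hist t \<omega>, act t \<omega>) \<in> D \<and> state (Suc t) \<omega> \<in> B} =
        (\<integral>\<^sup>+ \<omega>. indicator D (hist t \<omega>, act t \<omega>) * ennreal (measure (K (hist t \<omega>)) (actions M \<times> B)) \<partial>P)"
    proof
      fix D assume D: "D \<in> sets (Hist M t \<Otimes>\<^sub>M AB M)"
      let ?A = "(\<lambda>\<omega>. (hist t \<omega>, act t \<omega>)) -` D \<inter> space P"
      have A: "?A \<in> sets P" by (rule measurable_sets[OF ha D])
      have AF: "?A \<in> sets ?F" unfolding F_sets using D by blast
      have "(\<integral>\<omega>\<in>?A. indicator (E B) \<omega> \<partial>P) = (\<integral>\<omega>\<in>?A. real_cond_exp P ?F (indicator (E B)) \<omega> \<partial>P)"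
        by (rule F.real_cond_exp_intA[OF Eint[OF B] AF])
      also have "\<dots> = (\<integral>\<omega>\<in>?A. g B \<omega> \<partial>P)"
        unfolding set_lebesgue_integral_def
      proof (rule integral_cong_AE)
        show "(\<lambda>\<omega>. indicat_real ?A \<omega> *\<^sub>R real_cond_exp P ?F (indicator (E B)) \<omega>) \<in> borel_measurable P"
          using A by (intro borel_measurable_scaleR borel_measurable_indicator borel_measurable_cond_exp2) 
        show "(\<lambda>\<omega>. indicat_real ?A \<omega> *\<^sub>R g B \<omega>) \<in> borel_measurable P"
          using A gP[OF B] by (intro borel_measurable_scaleR borel_measurable_indicator)
        show "AE \<omega> in P. indicat_real ?A \<omega> *\<^sub>R real_cond_exp P ?F (indicator (E B)) \<omega> =
            indicat_real ?A \<omega> *\<^sub>R g B \<omega>"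
          using * by eventually_elim simp
      qed
      finally show "emeasure P {\<omega>\<in>space P. (hist t \<omega>, act t \<omega>) \<in> D \<and> state (Suc t) \<omega> \<in> B} =
        (\<integral>\<^sup>+ \<omega>. indicator D (hist t \<omega>, act t \<omega>) * ennreal (measure (K (hist t \<omega>)) (actions M \<times> B)) \<partial>P)"
        unfolding key[OF D B] .
    qed
  next
    assume R: "\<forall>D\<in>sets (Hist M t \<Otimes>\<^sub>M AB M).
      emeasure P {\<omega>\<in>space P. (hist t \<omega>, act t \<omega>) \<in> D \<and> state (Suc t) \<omega> \<in> B} =
        (\<integral>\<^sup>+ \<omega>. indicator D (hist t \<omega>, act t \<omega>) * ennreal (measure (K (hist t \<omega>)) (actions M \<times> B)) \<partial>P)"
    have "AE \<omega> in P. real_cond_exp P ?F (indicator (E B)) \<omega> = g B \<omega>"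
    proof (rule F.real_cond_exp_charact)
      fix A assume "A \<in> sets ?F"
      then obtain D where D: "D \<in> sets (Hist M t \<Otimes>\<^sub>M AB M)"
        and A: "A = (\<lambda>\<omega>. (hist t \<omega>, act t \<omega>)) -` D \<inter> space P" unfolding F_sets by blast
      show "(\<integral>\<omega>\<in>A. indicator (E B) \<omega> \<partial>P) = (\<integral>\<omega>\<in>A. g B \<omega> \<partial>P)"
        unfolding A key[OF D B] using R D by blast
    qed (use Eint gint gF B in auto)
    then show "AE \<omega> in P. real_cond_exp P ?F (indicator (E B)) \<omega> = measure (trans M (state t \<omega>) (act t \<omega>)) B"
      using gAE[OF B] by eventually_elim simp
  qed
  show ?thesis
    unfolding joint_eq_extend_iff using iff unfolding E_def by blast
qed

end

end

section \<open>Uniqueness and existence of the induced measure\<close>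

context ddp_theory
begin

text \<open>The version depends on the law \<open>\<mu>\<close> of the history; under a different
  law it may be wrong on a set of positive measure.\<close>

lemma step_kernel_version:
  assumes \<sigma>: "\<sigma> \<in> strategies M" and \<mu>: "prob_space \<mu>" "sets \<mu> = sets (Hist M t)"
    and us: "usets (mode M) (Hist M t) \<subseteq> sets (completion \<mu>)"
  shows "\<exists>K\<in>Hist M t \<rightarrow>\<^sub>M prob_algebra AS. AE h in \<mu>. K h = step_kernel \<sigma> t h"
proof -
  have "step_kernel \<sigma> t \<in> completion \<mu> \<rightarrow>\<^sub>M prob_algebra AS"
    by (rule measurable_completion_UM[OF us \<mu>(2) step_kernel_UM[OF \<sigma>]])
  from completion_ex_borel_kernel[OF prob_space.not_empty[OF \<mu>(1)] borel_AS sets_AS this]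
  show ?thesis using measurable_cong_sets[OF \<mu>(2) refl] by blast
qed

section \<open>Uniqueness of the induced measure\<close>

lemma is_inducedD:
  assumes "is_induced M \<sigma> s P"
  shows "prob_space P" "sets P = sets (Hinf M)" "AE \<omega> in P. fst \<omega> = s"
    "AE \<omega> in P. act t \<omega> = \<sigma> t (hist t \<omega>)"
  using assms by (auto simp: is_induced_def)

lemma is_induced_joint:
  assumes \<sigma>: "\<sigma> \<in> strategies M" and P: "is_induced M \<sigma> s P"
    and K: "K \<in> Hist M t \<rightarrow>\<^sub>M prob_algebra AS" "AE h in marg P t. K h = step_kernel \<sigma> t h"
  shows "joint P t = extend t K (marg P t)"
  by (subst cond_exp_iff[OF \<sigma> is_inducedD(1,2,4)[OF P] K, symmetric])
     (use P in \<open>simp add: is_induced_def\<close>)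

lemma marg_0:
  assumes P: "prob_space P" "sets P = sets (Hinf M)" "AE \<omega> in P. fst \<omega> = s"
  shows "marg P 0 = return (Hist M 0) (s, \<lambda>_. undefined)"
proof -
  interpret prob_space P by (rule P(1))
  have h0: "hist 0 \<omega> = (fst \<omega>, \<lambda>_. undefined)" for \<omega> :: "('s, 'a) history"
    by (simp add: hist_def restrict_def)
  have m: "hist 0 \<in> P \<rightarrow>\<^sub>M Hist M 0" by (rule measurable_Hinf_cong[OF P(2) measurable_hist])
  \<comment> \<open>That the starting history belongs to the space is read off from one point of
    this almost sure event, which is non-empty under a probability measure. The empty sequence of
    entries is represented by the constant function \<open>undefined\<close>.\<close>
  have "AE \<omega> in P. fst \<omega> = s \<and> hist 0 \<omega> \<in> space (Hist M 0)"
    using AE_space P(3) by eventually_elim (use measurable_space[OF m] in auto)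
  then obtain \<omega> where "fst \<omega> = s" "hist 0 \<omega> \<in> space (Hist M 0)"
    using eventually_happens'[OF ae_filter_bot] by blast
  then have c: "(s, \<lambda>_. undefined) \<in> space (Hist M 0)" by (simp add: h0)
  have "marg P 0 = distr P (Hist M 0) (\<lambda>_. (s, \<lambda>_. undefined))"
    unfolding marg_def
    by (rule distr_cong_AE) (use P(3) m c in \<open>auto simp: h0\<close>)
  also have "\<dots> = return (Hist M 0) (s, \<lambda>_. undefined)"
    by (rule distr_const[OF c])
  finally show ?thesis .
qed

text \<open>The initial state is almost surely \<open>s\<close>, so each measure is the image under
  \<open>Pair s\<close> of the law of its sequence of entries. That law is determined by finite
  cylinders, and a cylinder depends on a finite history only.\<close>

lemma Hinf_measure_eqI:
  assumes P: "prob_space P" "sets P = sets (Hinf M)" "AE \<omega> in P. fst \<omega> = s"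
    and P': "prob_space P'" "sets P' = sets (Hinf M)" "AE \<omega> in P'. fst \<omega> = s"
    and eq: "\<And>t. marg P t = marg P' t" and s: "s \<in> states M"
  shows "P = P'"
proof -
  let ?\<Pi> = "PiM UNIV (\<lambda>_::nat. AS)"
  have snd: "snd \<in> Hinf M \<rightarrow>\<^sub>M ?\<Pi>" unfolding Hinf_def by simp
  have pair: "Pair s \<in> ?\<Pi> \<rightarrow>\<^sub>M Hinf M" unfolding Hinf_def by (rule measurable_Pair1') (simp add: s)
  have rec: "distr (distr R ?\<Pi> snd) (Hinf M) (Pair s) = R"
    if R: "sets R = sets (Hinf M)" "AE \<omega> in R. fst \<omega> = s" for R
  proof -
    have sR: "snd \<in> R \<rightarrow>\<^sub>M ?\<Pi>" by (rule measurable_Hinf_cong[OF R(1) snd])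
    have "distr (distr R ?\<Pi> snd) (Hinf M) (Pair s) = distr R (Hinf M) (\<lambda>\<omega>. (s, snd \<omega>))"
      by (subst distr_distr[OF pair sR]) (simp add: comp_def)
    also have "\<dots> = distr R (Hinf M) (\<lambda>\<omega>. \<omega>)"
    proof (rule distr_cong_AE)
      show "AE \<omega> in R. (s, snd \<omega>) = \<omega>" using R(2) by eventually_elim auto
      show "(\<lambda>\<omega>. (s, snd \<omega>)) \<in> R \<rightarrow>\<^sub>M Hinf M" using measurable_compose[OF sR pair] by simp
      show "(\<lambda>\<omega>. \<omega>) \<in> R \<rightarrow>\<^sub>M Hinf M" by (rule measurable_Hinf_cong[OF R(1)]) simp
    qed simp_all
    also have "\<dots> = distr R R (\<lambda>\<omega>. \<omega>)" by (rule distr_cong) (use R in auto)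
    finally show ?thesis by simp
  qed
  have emb: "emeasure (distr R ?\<Pi> snd) (prod_emb UNIV (\<lambda>_. AS) J (Pi\<^sub>E J A)) =
      emeasure (marg R t) {h\<in>space (Hist M t). \<forall>i\<in>J. snd h i \<in> A i}"
    if R: "sets R = sets (Hinf M)" and J: "finite J" "J \<subseteq> {..<t}" and A: "\<And>i. i \<in> J \<Longrightarrow> A i \<in> sets AS"
    for R J A t
  proof -
    have sR: "snd \<in> R \<rightarrow>\<^sub>M ?\<Pi>" by (rule measurable_Hinf_cong[OF R(1) snd])
    have hR: "hist t \<in> R \<rightarrow>\<^sub>M Hist M t" by (rule measurable_Hinf_cong[OF R(1) measurable_hist])
    have c: "(\<lambda>h. snd h i) \<in> Hist M t \<rightarrow>\<^sub>M AS" if "i \<in> J" for i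
      unfolding Hist_def
      by (rule measurable_compose[OF measurable_snd], rule measurable_component_singleton)
         (use that J in auto)
    have S: "{h\<in>space (Hist M t). \<forall>i\<in>J. snd h i \<in> A i} \<in> sets (Hist M t)"
    proof (rule sets.sets_Collect_finite_All[OF _ J(1)])
      fix i assume i: "i \<in> J"
      have "{h \<in> space (Hist M t). snd h i \<in> A i} = (\<lambda>h. snd h i) -` A i \<inter> space (Hist M t)" by blast
      then show "{h \<in> space (Hist M t). snd h i \<in> A i} \<in> sets (Hist M t)"
        using measurable_sets[OF c[OF i] A[OF i]] by simp
    qed
    have E: "prod_emb UNIV (\<lambda>_. AS) J (Pi\<^sub>E J A) \<in> sets ?\<Pi>"
      by (rule sets_PiM_I) (use J A in auto)
    have "snd -` prod_emb UNIV (\<lambda>_. AS) J (Pi\<^sub>E J A) \<inter> space R =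
        hist t -` {h\<in>space (Hist M t). \<forall>i\<in>J. snd h i \<in> A i} \<inter> space R"
    proof -
      have "snd \<omega> \<in> prod_emb UNIV (\<lambda>_. AS) J (Pi\<^sub>E J A) \<longleftrightarrow>
          hist t \<omega> \<in> {h\<in>space (Hist M t). \<forall>i\<in>J. snd h i \<in> A i}" if "\<omega> \<in> space R" for \<omega>
      proof -
        have 1: "snd \<omega> \<in> space ?\<Pi>" "hist t \<omega> \<in> space (Hist M t)"
          using measurable_space[OF sR that] measurable_space[OF hR that] by auto
        have "snd (hist t \<omega>) i = snd \<omega> i" if "i \<in> J" for i
          using that J(2) by (auto simp: hist_def)
        then show ?thesis using 1 by (auto simp: prod_emb_def space_PiM)
      qed
      then show ?thesis by blast
    qed
    then show ?thesis
      unfolding marg_def by (simp add: emeasure_distr[OF sR E] emeasure_distr[OF hR S])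
  qed
  have "distr P ?\<Pi> snd = distr P' ?\<Pi> snd"
  proof (rule measure_eqI_PiM_infinite)
    fix A and J :: "nat set" assume J: "finite J" and A: "\<And>i. i \<in> J \<Longrightarrow> A i \<in> sets AS"
    \<comment> \<open>The horizon only has to exceed every index in \<open>J\<close>; for empty
      \<open>J\<close> the inclusion holds whatever \<open>Max J\<close> is.\<close>
    have "J \<subseteq> {..<Suc (Max J)}" using J by (auto simp: less_Suc_eq_le)
    then show "emeasure (distr P ?\<Pi> snd) (prod_emb UNIV (\<lambda>_. AS) J (Pi\<^sub>E J A)) =
        emeasure (distr P' ?\<Pi> snd) (prod_emb UNIV (\<lambda>_. AS) J (Pi\<^sub>E J A))"
      using emb[OF P(2) J _ A] emb[OF P'(2) J _ A] eq by simp
  next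
    interpret prob_space P by (rule P(1))
    show "finite_measure (distr P ?\<Pi> snd)"
      by (rule finite_measure_distr) (rule measurable_Hinf_cong[OF P(2) snd])
  qed simp_all
  then have "distr (distr P ?\<Pi> snd) (Hinf M) (Pair s) = distr (distr P' ?\<Pi> snd) (Hinf M) (Pair s)"
    by (rule arg_cong)
  then show ?thesis unfolding rec[OF P(2,3)] rec[OF P'(2,3)] .
qed

text \<open>The second clause has content only if every set counts as measurable, where it is part of
  \<open>well_posed\<close>.\<close>

definition admissible :: "('s, 'a) strategy \<Rightarrow> 's \<Rightarrow> ('s, 'a) history measure \<Rightarrow> bool" where
  "admissible \<sigma> s P \<longleftrightarrow> is_induced M \<sigma> s P \<and> (\<forall>t. usets (mode M) (Hist M t) \<subseteq> sets (completion (marg P t)))"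

text \<open>The assumption is asymmetric: the Borel kernel is chosen for the admissible measure. By
  the induction hypothesis the other measure has the same law of histories, so the kernel is a
  version for it too, and both have the same joint law with the next entry.\<close>

lemma induced_unique:
  assumes \<sigma>: "\<sigma> \<in> strategies M" and s: "s \<in> states M" and P: "admissible \<sigma> s P" and P': "is_induced M \<sigma> s P'"
  shows "P = P'"
proof (rule Hinf_measure_eqI)
  have iP: "is_induced M \<sigma> s P" and us: "\<And>t. usets (mode M) (Hist M t) \<subseteq> sets (completion (marg P t))"
    using P by (auto simp: admissible_def)
  note PD = is_inducedD[OF iP] and PD' = is_inducedD[OF P']
  show "prob_space P" "sets P = sets (Hinf M)" "AE \<omega> in P. fst \<omega> = s" by (fact PD)+
  show "prob_space P'" "sets P' = sets (Hinf M)" "AE \<omega> in P'. fst \<omega> = s" by (fact PD')+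
  show "s \<in> states M" by fact
  show "marg P t = marg P' t" for t
  proof (induction t)
    case 0
    show ?case using marg_0[OF PD(1-3)] marg_0[OF PD'(1-3)] by simp
  next
    case (Suc t)
    obtain K where K: "K \<in> Hist M t \<rightarrow>\<^sub>M prob_algebra AS" "AE h in marg P t. K h = step_kernel \<sigma> t h"
      using step_kernel_version[OF \<sigma> marg_prob(1)[OF PD(1,2)] sets_marg us] by blast
    have "joint P t = extend t K (marg P t)" by (rule is_induced_joint[OF \<sigma> iP K])
    moreover have "joint P' t = extend t K (marg P' t)"
      by (rule is_induced_joint[OF \<sigma> P' K(1) K(2)[unfolded Suc]])
    ultimately show ?case
      unfolding marg_Suc[OF PD(2)] marg_Suc[OF PD'(2)] using Suc by simp
  qed
qed

lemma induced_admissible: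
  assumes "\<sigma> \<in> strategies M" "s \<in> states M" "admissible \<sigma> s P"
  shows "induced M \<sigma> s = P"
  unfolding induced_def
proof (rule the_equality)
  show "is_induced M \<sigma> s P" using assms(3) by (simp add: admissible_def)
  show "P' = P" if "is_induced M \<sigma> s P'" for P'
    using induced_unique[OF assms that] by simp
qed

text \<open>The step kernel puts all its mass on the prescribed action, so the disintegration
  already forces actions to follow the strategy.\<close>

lemma joint_imp_AE_act:
  assumes \<sigma>: "\<sigma> \<in> strategies M" and P: "prob_space P" "sets P = sets (Hinf M)"
    and us: "usets (mode M) (Hist M t) \<subseteq> sets (completion (marg P t))"
    and K: "K \<in> Hist M t \<rightarrow>\<^sub>M prob_algebra AS" "AE h in marg P t. K h = step_kernel \<sigma> t h"
    and joint: "joint P t = extend t K (marg P t)"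
  shows "AE \<omega> in P. act t \<omega> = \<sigma> t (hist t \<omega>)"
proof -
  interpret \<mu>: prob_space "marg P t" by (rule marg_prob[OF P])
  have A: "actions M \<in> sets borel" using model by (simp add: ddp_model_def)
  have "\<sigma> t \<in> completion (marg P t) \<rightarrow>\<^sub>M AB M"
    by (rule measurable_completion_UM[OF us sets_marg strategiesD(1)[OF \<sigma>]])
  \<comment> \<open>The event that the action differs from the prescribed one need not be Borel.
    With a Borel version \<open>f\<close> of the strategy it becomes the Borel set \<open>N\<close>,
    described by a positive distance.\<close>
  from completion_ex_borel_map[OF \<mu>.not_empty A arg_cong[where f=sets, OF AB_def] this]
  obtain f where f: "f \<in> marg P t \<rightarrow>\<^sub>M AB M" "AE h in marg P t. f h = \<sigma> t h" by blast
  have id: "(\<lambda>x. x) \<in> AB M \<rightarrow>\<^sub>M borel" unfolding AB_def by (rule measurable_restrict_space1) simp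
  have "f \<in> Hist M t \<rightarrow>\<^sub>M AB M"
    using f(1) unfolding measurable_cong_sets[OF sets_marg refl] .
  from measurable_compose[OF this id] have f': "f \<in> Hist M t \<rightarrow>\<^sub>M borel" .
  have a: "(\<lambda>p. fst (snd p)) \<in> Hist M t \<Otimes>\<^sub>M AS \<rightarrow>\<^sub>M borel"
    by (rule measurable_compose[OF _ id]) measurable
  define N where "N = {p\<in>space (Hist M t \<Otimes>\<^sub>M AS). 0 < dist (fst (snd p)) (f (fst p))}"
  have N: "N \<in> sets (Hist M t \<Otimes>\<^sub>M AS)"
    unfolding N_def
    by (intro borel_measurable_less borel_measurable_const borel_measurable_dist a
        measurable_compose[OF measurable_fst f'])
  have "emeasure (joint P t) N = (\<integral>\<^sup>+ p. indicator N p \<partial>extend t K (marg P t))"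
    unfolding joint using N sets_extend[OF marg_prob(2)[OF P] K(1)] by simp
  also have "\<dots> = (\<integral>\<^sup>+ h. \<integral>\<^sup>+ y. indicator N (h, y) \<partial>K h \<partial>marg P t)"
    by (rule nn_integral_extend[OF marg_prob(2)[OF P] K(1)]) (use N in simp)
  also have "\<dots> = (\<integral>\<^sup>+ h. 0 \<partial>marg P t)"
  proof (rule nn_integral_cong_AE)
    show "AE h in marg P t. (\<integral>\<^sup>+ y. indicator N (h, y) \<partial>K h) = 0"
      using AE_space K(2) f(2)
    proof eventually_elim
      case (elim h)
      then have h: "h \<in> space (Hist M t)" by simp
      have NK: "Pair h -` N \<in> sets AS" by (rule sets_Pair1[OF N])
      have "(\<integral>\<^sup>+ y. indicator N (h, y) \<partial>K h) = (\<integral>\<^sup>+ y. indicator (Pair h -` N) y \<partial>step_kernel \<sigma> t h)"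
        unfolding elim by (rule nn_integral_cong) (auto split: split_indicator)
      also have "\<dots> = emeasure (step_kernel \<sigma> t h) (Pair h -` N)"
        by (rule nn_integral_indicator) (use NK in \<open>simp add: step_kernel_def\<close>)
      also have "\<dots> = emeasure (trans M (state t h) (\<sigma> t h)) (Pair (\<sigma> t h) -` (Pair h -` N) \<inter>
          space (trans M (state t h) (\<sigma> t h)))"
        unfolding step_kernel_def
      proof (rule emeasure_distr[OF _ NK])
        have "Pair (\<sigma> t h) \<in> SB M \<rightarrow>\<^sub>M AS"
          by (rule measurable_Pair1') (simp add: strategiesD(3)[OF \<sigma> h])
        then show "Pair (\<sigma> t h) \<in> trans M (state t h) (\<sigma> t h) \<rightarrow>\<^sub>M AS"
          using measurable_cong_sets[OF trans_prob(2)[OF space_Hist_memD(2)[OF h] strategiesD(3)[OF \<sigma> h]] refl]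
          by blast
      qed
      also have "Pair (\<sigma> t h) -` (Pair h -` N) = {}" using elim by (auto simp: N_def)
      finally show ?case by simp
    qed
  qed
  finally have "emeasure (joint P t) N = 0" by simp
  then have "AE p in joint P t. p \<notin> N"
    by (intro AE_not_in) (use N in \<open>simp add: null_sets_def\<close>)
  then have "AE p in joint P t. fst (snd p) = f (fst p)"
    using AE_space by eventually_elim (use sets_eq_imp_space_eq[OF sets_joint] in \<open>auto simp: N_def\<close>)
  from AE_distrD[OF measurable_Hinf_cong[OF P(2) measurable_joint] this[unfolded joint_def]]
  have "AE \<omega> in P. act t \<omega> = f (hist t \<omega>)" by (simp add: act_def)
  moreover have "AE \<omega> in P. f (hist t \<omega>) = \<sigma> t (hist t \<omega>)"
    by (rule AE_distrD[OF measurable_Hinf_cong[OF P(2) measurable_hist] f(2)[unfolded marg_def]])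
  ultimately show ?thesis by eventually_elim simp
qed

text \<open>Outside the case of all sets, generalised measurable sets belong to the completion of
  every law. A Borel kernel can thus be found whatever law the construction has produced so far, and
  these kernels are fed to the Ionescu-Tulcea theorem.\<close>

lemma admissible_exists_nontrivial:
  assumes \<sigma>: "\<sigma> \<in> strategies M" and s: "s \<in> states M" and mode: "mode M \<noteq> All_sets"
  shows "\<exists>P. admissible \<sigma> s P"
proof -
  \<comment> \<open>The initial state is fixed, so only the entries are constructed;
    \<open>Pair s\<close> turns them into histories. The index set has the form that
    \<open>Ionescu_Tulcea\<close> uses.\<close>
  define L where "L t = PiM {0..<t} (\<lambda>_::nat. AS)" for t
  have pair: "Pair s \<in> L t \<rightarrow>\<^sub>M Hist M t" for t
    unfolding L_def Hist_def lessThan_atLeast0 by (rule measurable_Pair1') (simp add: s)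
  have upd: "(\<lambda>(x, y). x(t := y)) \<in> L t \<Otimes>\<^sub>M AS \<rightarrow>\<^sub>M L (Suc t)" for t
    unfolding L_def case_prod_beta'
    by (rule measurable_fun_upd[where J="{0..<t}"]) auto
  \<comment> \<open>The choice is a function of the law \<open>\<nu>\<close>, since the law at date
    \<open>t\<close> becomes available only once the earlier kernels are fixed.\<close>
  define kk where "kk t \<nu> = (SOME K. K \<in> Hist M t \<rightarrow>\<^sub>M prob_algebra AS \<and>
      (AE h in distr \<nu> (Hist M t) (Pair s). K h = step_kernel \<sigma> t h))" for t \<nu>
  have kk: "kk t \<nu> \<in> Hist M t \<rightarrow>\<^sub>M prob_algebra AS \<and>
      (AE h in distr \<nu> (Hist M t) (Pair s). kk t \<nu> h = step_kernel \<sigma> t h)"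
    if \<nu>: "\<nu> \<in> space (prob_algebra (L t))" for t \<nu>
  proof -
    have "prob_space \<nu>" "sets \<nu> = sets (L t)" using \<nu> by (auto simp: space_prob_algebra)
    then have "prob_space (distr \<nu> (Hist M t) (Pair s))"
      using pair measurable_cong_sets[of \<nu> "L t" "Hist M t" "Hist M t"]
      by (intro prob_space.prob_space_distr) auto
    then have "\<exists>K\<in>Hist M t \<rightarrow>\<^sub>M prob_algebra AS. AE h in distr \<nu> (Hist M t) (Pair s). K h = step_kernel \<sigma> t h"
      by (intro step_kernel_version \<sigma> usets_subset_completion mode) auto
    then have "\<exists>K. K \<in> Hist M t \<rightarrow>\<^sub>M prob_algebra AS \<and>
        (AE h in distr \<nu> (Hist M t) (Pair s). K h = step_kernel \<sigma> t h)" by blast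
    from someI_ex[OF this] show ?thesis unfolding kk_def .
  qed
  \<comment> \<open>The law of the first \<open>t\<close> entries, where the kernel used at each
    date is the one chosen for the law reached there.\<close>
  define m where "m = rec_nat (return (L 0) (\<lambda>_. undefined))
      (\<lambda>t \<nu>. \<nu> \<bind> (\<lambda>x. distr (kk t \<nu> (s, x)) (L (Suc t)) (fun_upd x t)))"
  have m_0: "m 0 = return (L 0) (\<lambda>_. undefined)"
    and m_Suc: "m (Suc t) = m t \<bind> (\<lambda>x. distr (kk t (m t) (s, x)) (L (Suc t)) (fun_upd x t))" for t
    by (simp_all add: m_def)
  have step: "(\<lambda>x. distr (kk t \<nu> (s, x)) (L (Suc t)) (fun_upd x t)) \<in> L t \<rightarrow>\<^sub>M prob_algebra (L (Suc t))"
    if \<nu>: "\<nu> \<in> space (prob_algebra (L t))" for t \<nu>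
    by (rule measurable_distr_prob_space2[OF measurable_compose[OF pair] upd]) (use kk[OF \<nu>] in blast)
  have m: "m t \<in> space (prob_algebra (L t))" for t
  proof (induction t)
    case 0
    have "(\<lambda>_. undefined) \<in> space (L 0)" by (simp add: L_def space_PiM)
    then show ?case unfolding m_0 by (simp add: space_prob_algebra prob_space_return)
  next
    case (Suc t)
    show ?case
      unfolding m_Suc using prob_space_bind'[OF Suc step[OF Suc]] sets_bind'[OF Suc step[OF Suc]]
      by (simp add: space_prob_algebra)
  qed
  have mD: "prob_space (m t)" "sets (m t) = sets (L t)" "space (m t) = space (L t)" for t
    using m[of t] sets_eq_imp_space_eq[of "m t" "L t"] by (auto simp: space_prob_algebra)
  have kkm: "kk t (m t) \<in> Hist M t \<rightarrow>\<^sub>M prob_algebra AS" for t using kk[OF m] by blast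
  have kks: "(\<lambda>x. kk t (m t) (s, x)) \<in> L t \<rightarrow>\<^sub>M prob_algebra AS" for t
    by (rule measurable_compose[OF pair kkm])
  have IT_sub: "(\<lambda>x. kk t (m t) (s, x)) \<in> Pi\<^sub>M {0..<t} (\<lambda>_. AS) \<rightarrow>\<^sub>M subprob_algebra AS" for t
    using measurable_prob_algebraD[OF kks] by (simp add: L_def)
  have IT_prob: "prob_space (kk t (m t) (s, x))" if "x \<in> space (Pi\<^sub>M {0..<t} (\<lambda>_. AS))" for t x
    using measurable_space[OF kks, of x t] that by (simp add: L_def space_prob_algebra)
  interpret IT: Ionescu_Tulcea "\<lambda>t x. kk t (m t) (s, x)" "\<lambda>_. AS"
    by (rule Ionescu_Tulcea.intro[OF IT_sub IT_prob])
  \<comment> \<open>The recursion behind \<open>m\<close> is that of the Ionescu-Tulcea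
    construction, so each kernel has been chosen for exactly the law that the construction gives to
    the history.\<close>
  have C: "IT.C 0 t (\<lambda>_. undefined) = m t" for t
    by (induction t) (simp_all add: m_0 m_Suc L_def IT.eP_def[abs_def])
  have up: "IT.up_to {0..<t} = t" for t
  proof (rule antisym)
    show "IT.up_to {0..<t} \<le> t" by (simp add: IT.up_to_iff)
    show "t \<le> IT.up_to {0..<t}" using IT.up_to[of "{0..<t}"] by (cases "t = 0") auto
  qed
  have lim: "distr IT.PF.lim (L t) (\<lambda>x. restrict x {0..<t}) = m t" for t
  proof -
    have "distr IT.PF.lim (L t) (\<lambda>x. restrict x {0..<t}) = IT.CI {0..<t}"
      unfolding L_def by (rule IT.distr_lim) simp
    also have "\<dots> = distr (IT.C 0 t (\<lambda>_. undefined)) (Pi\<^sub>M {0..<t} (\<lambda>_. AS)) (\<lambda>x. restrict x {0..<t})"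
      unfolding IT.CI_def up ..
    also have "\<dots> = IT.C 0 t (\<lambda>_. undefined)"
      using IT.distr_C[of t t "\<lambda>_. undefined" 0] by simp
    finally show ?thesis by (simp add: C)
  qed
  let ?\<Pi> = "PiM UNIV (\<lambda>_::nat. AS)"
  have pairI: "Pair s \<in> ?\<Pi> \<rightarrow>\<^sub>M Hinf M" unfolding Hinf_def by (rule measurable_Pair1') (simp add: s)
  have lim_sets: "sets IT.PF.lim = sets ?\<Pi>" by simp
  have limI: "f \<in> IT.PF.lim \<rightarrow>\<^sub>M N" if "f \<in> ?\<Pi> \<rightarrow>\<^sub>M N" for f and N :: "'z measure"
    using that measurable_cong_sets[OF lim_sets refl] by blast
  have restr: "(\<lambda>x. restrict x {0..<t}) \<in> ?\<Pi> \<rightarrow>\<^sub>M L t" for t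
    unfolding L_def by (rule measurable_restrict_subset) simp
  have lim_prob: "prob_space IT.PF.lim"
  proof (rule prob_space_distrD[OF limI[OF restr]])
    show "prob_space (distr IT.PF.lim (L 0) (\<lambda>x. restrict x {0..<0}))" unfolding lim by (rule mD)
  qed
  define P where "P = distr IT.PF.lim (Hinf M) (Pair s)"
  have P: "prob_space P" "sets P = sets (Hinf M)"
    unfolding P_def using prob_space.prob_space_distr[OF lim_prob limI[OF pairI]] by auto
  have hist_s: "hist t (s, x) = (s, restrict x {0..<t})" for t x
    by (simp add: hist_def lessThan_atLeast0)
  have marg: "marg P t = distr (m t) (Hist M t) (Pair s)" for t
  proof -
    have "marg P t = distr IT.PF.lim (Hist M t) (\<lambda>x. (s, restrict x {0..<t}))"
      unfolding marg_def P_def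
      by (subst distr_distr[OF measurable_hist limI[OF pairI]]) (simp add: comp_def hist_s)
    also have "\<dots> = distr (distr IT.PF.lim (L t) (\<lambda>x. restrict x {0..<t})) (Hist M t) (Pair s)"
      by (subst distr_distr[OF pair limI[OF restr]]) (simp add: comp_def)
    finally show ?thesis unfolding lim .
  qed
  have us: "usets (mode M) (Hist M t) \<subseteq> sets (completion (marg P t))" for t
    by (rule usets_subset_completion[OF mode marg_prob(1)[OF P] sets_marg])
  have AEk: "AE h in marg P t. kk t (m t) h = step_kernel \<sigma> t h" for t
    unfolding marg using kk[OF m] by blast
  \<comment> \<open>History and next entry are both functions of the first \<open>Suc t\<close>
    entries, so the joint law can be computed from \<open>m (Suc t)\<close> and its
    recursion.\<close>
  have joint: "joint P t = extend t (kk t (m t)) (marg P t)" for t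
  proof (rule measure_eqI)
    show "sets (joint P t) = sets (extend t (kk t (m t)) (marg P t))"
      using sets_extend(1)[OF marg_prob(2)[OF P] kkm] by simp
    fix A assume "A \<in> sets (joint P t)"
    then have A: "A \<in> sets (Hist M t \<Otimes>\<^sub>M AS)" by simp
    let ?g = "\<lambda>x. ((s, restrict x {0..<t}), x t)"
    have g: "?g \<in> L (Suc t) \<rightarrow>\<^sub>M Hist M t \<Otimes>\<^sub>M AS"
    proof (rule measurable_Pair)
      show "(\<lambda>x. (s, restrict x {0..<t})) \<in> L (Suc t) \<rightarrow>\<^sub>M Hist M t"
        by (rule measurable_compose[OF _ pair]) (unfold L_def, rule measurable_restrict_subset, simp)
      show "(\<lambda>x. x t) \<in> L (Suc t) \<rightarrow>\<^sub>M AS"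
        unfolding L_def by (rule measurable_component_singleton) simp
    qed
    have "joint P t = distr IT.PF.lim (Hist M t \<Otimes>\<^sub>M AS) ?g"
      unfolding joint_def P_def
      by (subst distr_distr[OF measurable_joint limI[OF pairI]]) (simp add: comp_def hist_s)
    also have "\<dots> = distr (distr IT.PF.lim (L (Suc t)) (\<lambda>x. restrict x {0..<Suc t})) (Hist M t \<Otimes>\<^sub>M AS) ?g"
      by (subst distr_distr[OF g limI[OF restr]]) (simp add: comp_def min_def)
    finally have j: "joint P t = distr (m (Suc t)) (Hist M t \<Otimes>\<^sub>M AS) ?g" unfolding lim .
    have gm: "?g \<in> m (Suc t) \<rightarrow>\<^sub>M Hist M t \<Otimes>\<^sub>M AS"
      using g measurable_cong_sets[OF mD(2) refl] by blast
    have iA: "(\<lambda>x. indicator A (?g x) :: ennreal) \<in> borel_measurable (L (Suc t))"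
      by (rule measurable_compose[OF g]) (use A in simp)
    have "emeasure (joint P t) A = (\<integral>\<^sup>+ p. indicator A p \<partial>joint P t)"
      using A by simp
    also have "\<dots> = (\<integral>\<^sup>+ x. indicator A (?g x) \<partial>m (Suc t))"
      unfolding j by (rule nn_integral_distr[OF gm]) (use A in simp)
    also have "\<dots> = (\<integral>\<^sup>+ x. \<integral>\<^sup>+ z. indicator A (?g z) \<partial>distr (kk t (m t) (s, x)) (L (Suc t)) (fun_upd x t) \<partial>m t)"
      unfolding m_Suc
      by (rule nn_integral_bind[OF iA])
         (use measurable_prob_algebraD[OF step[OF m[of t]]] measurable_cong_sets[OF mD(2)[of t] refl] in blast)
    also have "\<dots> = (\<integral>\<^sup>+ x. \<integral>\<^sup>+ y. indicator A ((s, x), y) \<partial>kk t (m t) (s, x) \<partial>m t)"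
    proof (rule nn_integral_cong)
      fix x assume "x \<in> space (m t)"
      then have x: "x \<in> space (L t)" by (simp add: mD)
      have h: "(s, x) \<in> space (Hist M t)" by (rule measurable_space[OF pair x])
      have "fun_upd x t \<in> AS \<rightarrow>\<^sub>M L (Suc t)"
        using measurable_compose[OF measurable_Pair1'[OF x] upd[of t]] by simp
      then have u: "fun_upd x t \<in> kk t (m t) (s, x) \<rightarrow>\<^sub>M L (Suc t)"
        using measurable_cong_sets[OF kernel_memD(2)[OF kkm h] refl] by blast
      \<comment> \<open>Index \<open>t\<close> lies outside \<open>{0..<t}\<close>, and an element
        of the product is \<open>undefined\<close> there; overwriting and restricting gives it
        back.\<close>
      have e: "restrict (x(t := y)) {0..<t} = x" for y
        using x by (auto simp: L_def space_PiM PiE_def extensional_def fun_eq_iff)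
      have "(\<integral>\<^sup>+ z. indicator A (?g z) \<partial>distr (kk t (m t) (s, x)) (L (Suc t)) (fun_upd x t)) =
          (\<integral>\<^sup>+ y. indicator A (?g (x(t := y))) \<partial>kk t (m t) (s, x))"
        by (rule nn_integral_distr[OF u]) (use iA in simp)
      also have "\<dots> = (\<integral>\<^sup>+ y. indicator A ((s, x), y) \<partial>kk t (m t) (s, x))"
        unfolding e by simp
      finally show "(\<integral>\<^sup>+ z. indicator A (?g z) \<partial>distr (kk t (m t) (s, x)) (L (Suc t)) (fun_upd x t)) =
          (\<integral>\<^sup>+ y. indicator A ((s, x), y) \<partial>kk t (m t) (s, x))" .
    qed
    also have "\<dots> = (\<integral>\<^sup>+ h. \<integral>\<^sup>+ y. indicator A (h, y) \<partial>kk t (m t) h \<partial>marg P t)"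
      unfolding marg
    proof (rule nn_integral_distr[symmetric])
      show "Pair s \<in> m t \<rightarrow>\<^sub>M Hist M t" using pair measurable_cong_sets[OF mD(2) refl] by blast
      have "(\<lambda>h. \<integral>\<^sup>+ y. indicator A (h, y) \<partial>kk t (m t) h) \<in> borel_measurable (Hist M t)"
        by (rule nn_integral_measurable_subprob_algebra2[OF _ measurable_prob_algebraD[OF kkm]])
           (use A in simp)
      then show "(\<lambda>h. \<integral>\<^sup>+ y. indicator A (h, y) \<partial>kk t (m t) h) \<in> borel_measurable (distr (m t) (Hist M t) (Pair s))"
        by simp
    qed
    also have "\<dots> = (\<integral>\<^sup>+ p. indicator A p \<partial>extend t (kk t (m t)) (marg P t))"
      by (rule nn_integral_extend[symmetric, OF marg_prob(2)[OF P] kkm]) (use A in simp)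
    also have "\<dots> = emeasure (extend t (kk t (m t)) (marg P t)) A"
      using A sets_extend(1)[OF marg_prob(2)[OF P] kkm] by simp
    finally show "emeasure (joint P t) A = emeasure (extend t (kk t (m t)) (marg P t)) A" .
  qed
  \<comment> \<open>The disintegration is established before this, as \<open>cond_exp_iff\<close>
    presupposes that actions follow the strategy.\<close>
  have act: "AE \<omega> in P. act t \<omega> = \<sigma> t (hist t \<omega>)" for t
    by (rule joint_imp_AE_act[OF \<sigma> P us kkm AEk joint])
  have "AE \<omega> in P. state 0 \<omega> = s"
  proof -
    \<comment> \<open>Transferring an almost sure statement to an image measure by
      \<open>AE_distr_iff\<close> requires a measurable event; this one is measurable because
      singletons are Borel.\<close>
    have "{\<omega> \<in> space (Hinf M). fst \<omega> = s} \<in> sets (Hinf M)"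
    proof -
      have "{s} \<in> sets (SB M)"
        using model s by (auto simp: SB_def sets_restrict_space_iff ddp_model_def)
      moreover have "fst \<in> Hinf M \<rightarrow>\<^sub>M SB M" unfolding Hinf_def by simp
      ultimately have "fst -` {s} \<inter> space (Hinf M) \<in> sets (Hinf M)" by (intro measurable_sets)
      moreover have "{\<omega> \<in> space (Hinf M). fst \<omega> = s} = fst -` {s} \<inter> space (Hinf M)" by blast
      ultimately show ?thesis by simp
    qed
    then show ?thesis
      unfolding P_def by (subst AE_distr_iff[OF limI[OF pairI]]) auto
  qed
  moreover have "\<forall>B\<in>sets (SB M). AE \<omega> in P.
      real_cond_exp P (vimage_algebra (space P) (\<lambda>\<omega>. (hist t \<omega>, act t \<omega>)) (Hist M t \<Otimes>\<^sub>M AB M))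
        (indicator {\<omega>\<in>space P. state (Suc t) \<omega> \<in> B}) \<omega>
      = measure (trans M (state t \<omega>) (act t \<omega>)) B" for t
    by (subst cond_exp_iff[OF \<sigma> P act kkm AEk]) (rule joint)
  ultimately have "is_induced M \<sigma> s P"
    unfolding is_induced_def using P act by blast
  then show ?thesis using us unfolding admissible_def by blast
qed

lemma admissible_exists:
  assumes \<sigma>: "\<sigma> \<in> strategies M" and s: "s \<in> states M"
  shows "\<exists>P. admissible \<sigma> s P"
proof (cases "mode M = All_sets")
  case True
  then have "well_posed M" using model by (simp add: ddp_model_def)
  then show ?thesis using \<sigma> s unfolding well_posed_def admissible_def marg_def by blast
next
  case False
  then show ?thesis by (rule admissible_exists_nontrivial[OF \<sigma> s])
qed

end

section \<open>Values of strategies\<close>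

text \<open>A bind is the join of the law of the kernel; the bounds on \<open>f\<close> and on the
  total masses justify exchanging the integrals.\<close>

lemma integral_bind_bounded:
  fixes f :: "_ \<Rightarrow> real"
  assumes \<mu>: "\<mu> \<in> space (prob_algebra X)" and N: "N \<in> X \<rightarrow>\<^sub>M prob_algebra Y"
    and f: "f \<in> borel_measurable Y" "\<And>y. y \<in> space Y \<Longrightarrow> \<bar>f y\<bar> \<le> b"
  shows "(\<integral>y. f y \<partial>(\<mu> \<bind> N)) = (\<integral>x. (\<integral>y. f y \<partial>N x) \<partial>\<mu>)"
proof -
  have s: "sets \<mu> = sets X" and p: "prob_space \<mu>" using \<mu> by (auto simp: space_prob_algebra)
  interpret prob_space \<mu> by fact
  have N': "N \<in> \<mu> \<rightarrow>\<^sub>M subprob_algebra Y"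
    using measurable_prob_algebraD[OF N] measurable_cong_sets[OF s refl] by blast
  have "(\<integral>y. f y \<partial>(\<mu> \<bind> N)) = (\<integral>y. f y \<partial>join (distr \<mu> (subprob_algebra Y) N))"
    using bind_nonempty''[OF N' not_empty] by simp
  also have "\<dots> = (\<integral>R. (\<integral>y. f y \<partial>R) \<partial>distr \<mu> (subprob_algebra Y) N)"
  proof (rule integral_join[OF f])
    show "sets (distr \<mu> (subprob_algebra Y) N) = sets (subprob_algebra Y)" by simp
    show "finite_measure (distr \<mu> (subprob_algebra Y) N)" by (rule finite_measure_distr[OF N'])
    show "AE R in distr \<mu> (subprob_algebra Y) N. emeasure R (space R) \<le> ennreal 1"
      by (rule AE_I2) (simp add: space_subprob_algebra subprob_space.subprob_emeasure_le_1)
  qed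
  also have "\<dots> = (\<integral>x. (\<integral>y. f y \<partial>N x) \<partial>\<mu>)"
    by (rule integral_distr[OF N' integral_measurable_subprob_algebra[OF f(1)]])
  finally show ?thesis .
qed

text \<open>Passing to the completion does not change nonnegative integrals, and these do not
  distinguish functions that agree almost everywhere; so \<open>X\<close> may be replaced by the
  integrable \<open>Y\<close>. Both parts are then finite, and their difference is the Bochner
  integral.\<close>

lemma expect_eq_integral:
  assumes Y: "integrable P Y" and XY: "AE \<omega> in P. X \<omega> = ereal (Y \<omega>)"
  shows "expect P X = ereal (\<integral>\<omega>. Y \<omega> \<partial>P)"
proof -
  have 1: "(\<integral>\<^sup>+ \<omega>. e2ennreal (X \<omega>) \<partial>completion P) = (\<integral>\<^sup>+ \<omega>. ennreal (Y \<omega>) \<partial>P)"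
    unfolding nn_integral_completion
    by (rule nn_integral_cong_AE) (use XY in \<open>eventually_elim, simp\<close>)
  have 2: "(\<integral>\<^sup>+ \<omega>. e2ennreal (- X \<omega>) \<partial>completion P) = (\<integral>\<^sup>+ \<omega>. ennreal (- Y \<omega>) \<partial>P)"
    unfolding nn_integral_completion
    by (rule nn_integral_cong_AE) (use XY in \<open>eventually_elim, simp\<close>)
  have fin: "(\<integral>\<^sup>+ \<omega>. ennreal (Y \<omega>) \<partial>P) \<noteq> \<infinity>" "(\<integral>\<^sup>+ \<omega>. ennreal (- Y \<omega>) \<partial>P) \<noteq> \<infinity>"
    using Y by (auto simp: real_integrable_def)
  have r: "enn2ereal z = ereal (enn2real z)" if "z \<noteq> \<infinity>" for z
    using that by (cases z) auto
  show ?thesis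
    unfolding expect_def 1 2 r[OF fin(1)] r[OF fin(2)] real_lebesgue_integral_def[OF Y] by simp
qed

context ddp_theory
begin

text \<open>Feasibility matters in the case of all sets, where the claim is a clause of
  \<open>well_posed\<close> about feasible actions.\<close>

lemma usets_trans:
  assumes "s \<in> states M" "a \<in> \<Gamma> M s"
  shows "usets (mode M) (SB M) \<subseteq> sets (completion (trans M s a))"
proof (cases "mode M = All_sets")
  case True
  then have "well_posed M" using model by (simp add: ddp_model_def)
  then show ?thesis using assms unfolding well_posed_def by blast
next
  case False
  show ?thesis
    by (rule usets_subset_completion[OF False trans_prob(1,2)]) (use assms in \<open>auto simp: \<Gamma>_def\<close>)
qed

lemma payoff_UM: "(\<lambda>p. payoff M (fst p) (snd p)) \<in> UM (mode M) (SB M \<Otimes>\<^sub>M AB M) \<rightarrow>\<^sub>M borel"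
  using model unfolding ddp_model_def umeas_eq_measurable by (simp add: case_prod_beta')

text \<open>Truncating a Borel version at the bound leaves it unchanged wherever it agrees with
  \<open>G\<close>, and makes the bound hold everywhere instead of almost everywhere. The absolute
  value of \<open>b\<close> keeps the truncation interval non-empty for every sign of
  \<open>b\<close>.\<close>

lemma bounded_version:
  fixes G :: "('s, 'a) history \<Rightarrow> real"
  assumes us: "usets (mode M) (Hist M t) \<subseteq> sets (completion (marg P t))"
    and G: "G \<in> UM (mode M) (Hist M t) \<rightarrow>\<^sub>M borel" and b: "\<And>h. h \<in> space (Hist M t) \<Longrightarrow> \<bar>G h\<bar> \<le> b"
  shows "\<exists>g\<in>borel_measurable (Hist M t). (\<forall>h. \<bar>g h\<bar> \<le> \<bar>b\<bar>) \<and> (AE h in marg P t. g h = G h)"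
proof -
  have "G \<in> borel_measurable (completion (marg P t))"
    by (rule measurable_completion_UM[OF us sets_marg G])
  from completion_ex_borel_measurable_real[OF this]
  obtain g where g: "g \<in> borel_measurable (marg P t)" "AE h in marg P t. G h = g h" by blast
  have g': "g \<in> borel_measurable (Hist M t)"
    using g(1) unfolding measurable_cong_sets[OF sets_marg refl] .
  have "AE h in marg P t. max (- \<bar>b\<bar>) (min \<bar>b\<bar> (g h)) = G h"
    using g(2) AE_space
  proof eventually_elim
    case (elim h)
    then have "\<bar>G h\<bar> \<le> b" by (intro b) simp
    then show ?case unfolding elim(1)[symmetric] by linarith
  qed
  moreover have "(\<lambda>h. max (- \<bar>b\<bar>) (min \<bar>b\<bar> (g h))) \<in> borel_measurable (Hist M t)"
    using g' by (intro borel_measurable_max borel_measurable_min borel_measurable_const)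
  moreover have "\<forall>h. \<bar>max (- \<bar>b\<bar>) (min \<bar>b\<bar> (g h))\<bar> \<le> \<bar>b\<bar>" by (auto simp: abs_le_iff)
  ultimately show ?thesis
    by (intro bexI[of _ "\<lambda>h. max (- \<bar>b\<bar>) (min \<bar>b\<bar> (g h))"] conjI)
qed

text \<open>Admissibility concerns generalised measurable sets of histories, whereas \<open>V\<close> is evaluated at
  the next state. Passing to a Borel version \<open>F\<close> of \<open>V\<close> on the one-step extension of histories avoids
  any statement about the law of the next state itself.\<close>

lemma integral_next_state:
  fixes V :: "'s \<Rightarrow> real"
  assumes \<sigma>: "\<sigma> \<in> strategies M" and P: "admissible \<sigma> s P"
    and V: "V \<in> UM (mode M) (SB M) \<rightarrow>\<^sub>M borel" "\<And>x. x \<in> states M \<Longrightarrow> \<bar>V x\<bar> \<le> b"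
  shows "\<exists>w J. w \<in> borel_measurable P \<and> J \<in> borel_measurable P \<and> (\<forall>\<omega>. \<bar>w \<omega>\<bar> \<le> \<bar>b\<bar>) \<and>
    integrable P J \<and>
    (AE \<omega> in P. w \<omega> = V (state (Suc t) \<omega>)) \<and>
    (AE \<omega> in P. J \<omega> = (\<integral>s'. V s' \<partial>completion (trans M (state t \<omega>) (act t \<omega>)))) \<and>
    (\<integral>\<omega>. w \<omega> \<partial>P) = (\<integral>\<omega>. J \<omega> \<partial>P)"
proof -
  have iP: "is_induced M \<sigma> s P" and us: "\<And>t. usets (mode M) (Hist M t) \<subseteq> sets (completion (marg P t))"
    using P by (auto simp: admissible_def)
  note PD = is_inducedD[OF iP]
  interpret prob_space P by (rule PD(1))
  have hP: "hist t \<in> P \<rightarrow>\<^sub>M Hist M t" by (rule measurable_Hinf_cong[OF PD(2) measurable_hist])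
  have jP: "(\<lambda>\<omega>. (hist t \<omega>, snd \<omega> t)) \<in> P \<rightarrow>\<^sub>M Hist M t \<Otimes>\<^sub>M AS"
    by (rule measurable_Hinf_cong[OF PD(2) measurable_joint])
  let ?Z = "Hist M t \<Otimes>\<^sub>M AS"
  have "(\<lambda>h. V (state (Suc t) h)) \<in> UM (mode M) (Hist M (Suc t)) \<rightarrow>\<^sub>M borel"
    by (rule UM_compose[OF measurable_UM[OF measurable_state] V(1)])
  from bounded_version[OF us this, of b]
  obtain g where g: "g \<in> borel_measurable (Hist M (Suc t))" "\<And>h. \<bar>g h\<bar> \<le> \<bar>b\<bar>"
    "AE h in marg P (Suc t). g h = V (state (Suc t) h)"
    using V(2) space_Hist_memD(2) by blast
  define F where "F p = g (ext t p)" for p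
  have F: "F \<in> borel_measurable ?Z" unfolding F_def[abs_def] by (rule measurable_compose[OF measurable_ext g(1)])
  have Fb: "\<bar>F p\<bar> \<le> \<bar>b\<bar>" for p unfolding F_def by (rule g(2))
  obtain K where K: "K \<in> Hist M t \<rightarrow>\<^sub>M prob_algebra AS" "AE h in marg P t. K h = step_kernel \<sigma> t h"
    using step_kernel_version[OF \<sigma> marg_prob(1)[OF PD(1,2)] sets_marg us] by blast
  have joint: "joint P t = extend t K (marg P t)" by (rule is_induced_joint[OF \<sigma> iP K])
  note KP = measurable_kernel_Pair[OF K(1)]
  have ej: "ext t \<in> joint P t \<rightarrow>\<^sub>M Hist M (Suc t)"
    using measurable_ext[of t] measurable_cong_sets[OF sets_joint refl] by blast
  have FV: "AE p in joint P t. F p = V (snd (snd p))"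
    using AE_distrD[OF ej g(3)[unfolded marg_Suc[OF PD(2)]]] by (simp add: F_def)
  \<comment> \<open>\<open>w\<close> is a version of \<open>V\<close> at the next state, and
    \<open>J\<close> integrates it over the kernel given the history. Their expectations agree by
    the disintegration; it remains to recognise \<open>J\<close> as the integral of \<open>V\<close>
    against the transition law.\<close>
  define w where "w \<omega> = F (hist t \<omega>, snd \<omega> t)" for \<omega>
  define J' where "J' h = (\<integral>p. F p \<partial>distr (K h) ?Z (Pair h))" for h
  define J where "J \<omega> = J' (hist t \<omega>)" for \<omega>
  have w: "w \<in> borel_measurable P" unfolding w_def[abs_def] by (rule measurable_compose[OF jP F])
  have J'm: "J' \<in> borel_measurable (Hist M t)"
    unfolding J'_def[abs_def]
    by (rule measurable_compose[OF measurable_prob_algebraD[OF KP] integral_measurable_subprob_algebra[OF F]])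
  have J: "J \<in> borel_measurable P" unfolding J_def[abs_def] by (rule measurable_compose[OF hP J'm])
  have J'b: "\<bar>J' h\<bar> \<le> \<bar>b\<bar>" if h: "h \<in> space (Hist M t)" for h
  proof -
    interpret D: prob_space "distr (K h) ?Z (Pair h)"
      using measurable_space[OF KP h] by (simp add: space_prob_algebra)
    have "integrable (distr (K h) ?Z (Pair h)) F"
      by (rule D.integrable_const_bound[of _ "\<bar>b\<bar>"]) (use F Fb in auto)
    then have "\<bar>J' h\<bar> \<le> (\<integral>p. \<bar>F p\<bar> \<partial>distr (K h) ?Z (Pair h))"
      unfolding J'_def by (intro integral_abs_bound)
    also have "\<dots> \<le> \<bar>b\<bar>"
      by (rule D.integral_le_const) (use \<open>integrable _ F\<close> Fb in auto)
    finally show ?thesis .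
  qed
  have Jint: "integrable P J"
    by (rule integrable_const_bound[of _ "\<bar>b\<bar>", OF _ J])
       (use J'b measurable_space[OF hP] in \<open>auto simp: J_def intro!: AE_I2\<close>)
  have wV: "AE \<omega> in P. w \<omega> = V (state (Suc t) \<omega>)"
    using AE_distrD[OF jP FV[unfolded joint_def]] by (simp add: w_def state_Suc)
  have "(\<integral>\<omega>. w \<omega> \<partial>P) = (\<integral>p. F p \<partial>joint P t)"
    unfolding w_def joint_def by (rule integral_distr[OF jP F, symmetric])
  also have "\<dots> = (\<integral>h. J' h \<partial>marg P t)"
    unfolding joint extend_def J'_def
    by (rule integral_bind_bounded[OF marg_prob(2)[OF PD(1,2)] KP F Fb])
  also have "\<dots> = (\<integral>\<omega>. J \<omega> \<partial>P)"
    unfolding J_def marg_def by (rule integral_distr[OF hP J'm])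
  finally have wJ: "(\<integral>\<omega>. w \<omega> \<partial>P) = (\<integral>\<omega>. J \<omega> \<partial>P)" .
  \<comment> \<open>The set where \<open>F\<close> and \<open>V\<close> differ need not be
    measurable. It is enclosed in a null set of the joint law, whose sections are null for almost
    every history.\<close>
  obtain N where N: "N \<in> null_sets (joint P t)" "{p\<in>space (joint P t). F p \<noteq> V (snd (snd p))} \<subseteq> N"
    using FV unfolding eventually_ae_filter by blast
  have NZ: "N \<in> sets ?Z" using N(1) sets_joint by (auto simp: null_sets_def)
  have "AE p in marg P t \<bind> (\<lambda>h. distr (K h) ?Z (Pair h)). p \<notin> N"
    using AE_not_in[OF N(1)] unfolding joint extend_def .
  moreover have "(\<lambda>h. distr (K h) ?Z (Pair h)) \<in> marg P t \<rightarrow>\<^sub>M subprob_algebra ?Z"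
    using measurable_prob_algebraD[OF KP] unfolding measurable_cong_sets[OF sets_marg refl] .
  ultimately have NK: "AE h in marg P t. AE p in distr (K h) ?Z (Pair h). p \<notin> N"
    by (subst (asm) AE_bind) (use NZ in auto)
  have J'V: "AE h in marg P t. J' h = (\<integral>s'. V s' \<partial>completion (trans M (state t h) (\<sigma> t h)))"
    using NK K(2) AE_space
  proof eventually_elim
    case (elim h)
    then have h: "h \<in> space (Hist M t)" by simp
    let ?T = "trans M (state t h) (\<sigma> t h)"
    have a: "\<sigma> t h \<in> actions M" "\<sigma> t h \<in> \<Gamma> M (state t h)" and st: "state t h \<in> states M"
      using strategiesD[OF \<sigma>] h space_Hist_memD by auto
    have T: "sets ?T = sets (SB M)" "space ?T = states M" by (rule trans_prob[OF st a(1)])+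
    have mT: "Pair (\<sigma> t h) \<in> ?T \<rightarrow>\<^sub>M AS"
      unfolding measurable_cong_sets[OF T(1) refl] by (rule measurable_Pair1') (simp add: a)
    have mK: "Pair h \<in> K h \<rightarrow>\<^sub>M ?Z" by (rule kernel_memD[OF K(1) h])
    have mTZ: "(\<lambda>s'. (h, \<sigma> t h, s')) \<in> ?T \<rightarrow>\<^sub>M ?Z"
      by (rule measurable_compose[OF mT measurable_Pair1'[OF h]])
    \<comment> \<open>For such a history the version coincides with the step kernel, so integrating
      over the entry is integrating over the next state with the transition law itself.\<close>
    have dist: "distr (K h) ?Z (Pair h) = distr ?T ?Z (\<lambda>s'. (h, \<sigma> t h, s'))"
      unfolding elim(2) step_kernel_def
      by (subst distr_distr[OF measurable_Pair1'[OF h] mT]) (simp add: comp_def)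
    have "AE s' in ?T. (h, \<sigma> t h, s') \<notin> N"
      by (rule AE_distrD[OF mTZ elim(1)[unfolded dist]])
    then have FVT: "AE s' in ?T. F (h, \<sigma> t h, s') = V s'"
      using AE_space
    proof eventually_elim
      case (elim s')
      have "(h, \<sigma> t h, s') \<in> space (joint P t)"
        using measurable_space[OF mTZ elim(2)] sets_eq_imp_space_eq[OF sets_joint] by simp
      then show ?case using N(2) elim(1) by auto
    qed
    have "J' h = (\<integral>s'. F (h, \<sigma> t h, s') \<partial>?T)"
      unfolding J'_def dist by (rule integral_distr[OF mTZ F])
    \<comment> \<open>\<open>F\<close> is Borel while \<open>V\<close> is measurable only for the
      completion, so the measure is completed before one is exchanged for the other.\<close>
    also have "\<dots> = (\<integral>s'. F (h, \<sigma> t h, s') \<partial>completion ?T)"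
      by (rule integral_completion[symmetric]) (rule measurable_compose[OF mTZ F])
    also have "\<dots> = (\<integral>s'. V s' \<partial>completion ?T)"
    proof (rule integral_cong_AE)
      show "(\<lambda>s'. F (h, \<sigma> t h, s')) \<in> borel_measurable (completion ?T)"
        by (rule measurable_completion) (rule measurable_compose[OF mTZ F])
      show "V \<in> borel_measurable (completion ?T)"
        by (rule measurable_completion_UM[OF usets_trans[OF st a(2)] T(1) V(1)])
      show "AE s' in completion ?T. F (h, \<sigma> t h, s') = V s'" using FVT by (rule AE_completion)
    qed
    finally show ?case .
  qed
  have "AE \<omega> in P. J \<omega> = (\<integral>s'. V s' \<partial>completion (trans M (state t \<omega>) (act t \<omega>)))"
    using AE_distrD[OF hP J'V[unfolded marg_def]] PD(4)[of t]
    by eventually_elim (simp add: J_def)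
  then show ?thesis using w J Jint wV wJ Fb unfolding w_def by blast
qed

text \<open>With \<open>e t\<close> the expected payoff and \<open>v t\<close> the expected value of
  \<open>V\<close> at date \<open>t\<close>, taking expectations in the hypothesis on
  \<open>Q\<close> gives \<open>e t + discount M * v (Suc t) \<le> v t\<close>. Weighted with powers
  of the discount factor, these inequalities sum to the first claim. The second replaces them by
  equalities along the strategy and shares the rest of the argument.\<close>

lemma verification:
  fixes V :: "'s \<Rightarrow> real"
  assumes \<sigma>: "\<sigma> \<in> strategies M" and s: "s \<in> states M"
    and V: "V \<in> UM (mode M) (SB M) \<rightarrow>\<^sub>M borel" "\<And>x. x \<in> states M \<Longrightarrow> \<bar>V x\<bar> \<le> b"
    and R: "\<And>x a. x \<in> states M \<Longrightarrow> a \<in> \<Gamma> M x \<Longrightarrow> \<bar>payoff M x a\<bar> \<le> R"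
    and Q: "\<And>x a. x \<in> states M \<Longrightarrow> a \<in> \<Gamma> M x \<Longrightarrow> Q M x a V \<le> V x"
  shows "strategy_value M \<sigma> s \<le> ereal (V s)"
    and "(\<And>t h. h \<in> space (Hist M t) \<Longrightarrow> Q M (state t h) (\<sigma> t h) V = V (state t h)) \<Longrightarrow>
      strategy_value M \<sigma> s = ereal (V s)"
proof -
  let ?\<beta> = "discount M"
  note \<beta> = discount
  obtain P where P: "admissible \<sigma> s P" using admissible_exists[OF \<sigma> s] by blast
  have iP: "is_induced M \<sigma> s P" and us: "\<And>t. usets (mode M) (Hist M t) \<subseteq> sets (completion (marg P t))"
    using P by (auto simp: admissible_def)
  note PD = is_inducedD[OF iP]
  interpret prob_space P by (rule PD(1))
  have hP: "hist t \<in> P \<rightarrow>\<^sub>M Hist M t" for t by (rule measurable_Hinf_cong[OF PD(2) measurable_hist])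
  have "\<exists>\<rho>\<in>borel_measurable P. (\<forall>\<omega>. \<bar>\<rho> \<omega>\<bar> \<le> \<bar>R\<bar>) \<and> (AE \<omega> in P. \<rho> \<omega> = payoff M (state t \<omega>) (act t \<omega>))" for t
  proof -
    have "(\<lambda>h. payoff M (state t h) (\<sigma> t h)) \<in> UM (mode M) (Hist M t) \<rightarrow>\<^sub>M borel"
      using UM_compose[OF state_action_UM[OF \<sigma>] payoff_UM] by simp
    from bounded_version[OF us this, of R]
    obtain g where g: "g \<in> borel_measurable (Hist M t)" "\<And>h. \<bar>g h\<bar> \<le> \<bar>R\<bar>"
      "AE h in marg P t. g h = payoff M (state t h) (\<sigma> t h)"
      using R strategiesD(2)[OF \<sigma>] space_Hist_memD(2) by blast
    have "AE \<omega> in P. g (hist t \<omega>) = payoff M (state t \<omega>) (act t \<omega>)"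
      using AE_distrD[OF hP g(3)[unfolded marg_def]] PD(4)[of t] by eventually_elim simp
    moreover have "(\<lambda>\<omega>. g (hist t \<omega>)) \<in> borel_measurable P" by (rule measurable_compose[OF hP g(1)])
    ultimately show ?thesis using g(2) by (intro bexI[of _ "\<lambda>\<omega>. g (hist t \<omega>)"]) auto
  qed
  then have "\<forall>t. \<exists>\<rho>. \<rho> \<in> borel_measurable P \<and> (\<forall>\<omega>. \<bar>\<rho> \<omega>\<bar> \<le> \<bar>R\<bar>) \<and>
    (AE \<omega> in P. \<rho> \<omega> = payoff M (state t \<omega>) (act t \<omega>))" by blast
  from choice[OF this] obtain \<rho> where \<rho>_all: "\<forall>t. \<rho> t \<in> borel_measurable P \<and>
    (\<forall>\<omega>. \<bar>\<rho> t \<omega>\<bar> \<le> \<bar>R\<bar>) \<and> (AE \<omega> in P. \<rho> t \<omega> = payoff M (state t \<omega>) (act t \<omega>))" by blast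
  have \<rho>: "\<rho> t \<in> borel_measurable P" "\<bar>\<rho> t \<omega>\<bar> \<le> \<bar>R\<bar>"
    "AE \<omega> in P. \<rho> t \<omega> = payoff M (state t \<omega>) (act t \<omega>)" for t \<omega>
    using \<rho>_all by blast+
  \<comment> \<open>The two versions are packed into a pair so that one application of choice
    selects both for all dates.\<close>
  have "\<forall>t. \<exists>p. fst p \<in> borel_measurable P \<and> snd p \<in> borel_measurable P \<and> (\<forall>\<omega>. \<bar>fst p \<omega>\<bar> \<le> \<bar>b\<bar>) \<and>
    integrable P (snd p) \<and>
    (AE \<omega> in P. fst p \<omega> = V (state (Suc t) \<omega>)) \<and>
    (AE \<omega> in P. snd p \<omega> = (\<integral>s'. V s' \<partial>completion (trans M (state t \<omega>) (act t \<omega>)))) \<and>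
    (\<integral>\<omega>. fst p \<omega> \<partial>P) = (\<integral>\<omega>. snd p \<omega> \<partial>P)"
    using integral_next_state[OF \<sigma> P V] by simp
  from choice[OF this] obtain p where p_all: "\<forall>t. fst (p t) \<in> borel_measurable P \<and> snd (p t) \<in> borel_measurable P \<and> (\<forall>\<omega>. \<bar>fst (p t) \<omega>\<bar> \<le> \<bar>b\<bar>) \<and>
    integrable P (snd (p t)) \<and>
    (AE \<omega> in P. fst (p t) \<omega> = V (state (Suc t) \<omega>)) \<and>
    (AE \<omega> in P. snd (p t) \<omega> = (\<integral>s'. V s' \<partial>completion (trans M (state t \<omega>) (act t \<omega>)))) \<and>
    (\<integral>\<omega>. fst (p t) \<omega> \<partial>P) = (\<integral>\<omega>. snd (p t) \<omega> \<partial>P)"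
    by blast
  have p: "fst (p t) \<in> borel_measurable P" "\<bar>fst (p t) \<omega>\<bar> \<le> \<bar>b\<bar>" "integrable P (snd (p t))"
    "AE \<omega> in P. fst (p t) \<omega> = V (state (Suc t) \<omega>)"
    "AE \<omega> in P. snd (p t) \<omega> = (\<integral>s'. V s' \<partial>completion (trans M (state t \<omega>) (act t \<omega>)))"
    "(\<integral>\<omega>. fst (p t) \<omega> \<partial>P) = (\<integral>\<omega>. snd (p t) \<omega> \<partial>P)" for t \<omega>
    using p_all by blast+
  \<comment> \<open>At date 0 the constant \<open>V s\<close> is taken, which makes
    \<open>v 0 = V s\<close> immediate; at later dates \<open>w\<close> is the version whose
    expectation \<open>integral_next_state\<close> computes.\<close>
  define w where "w t = (case t of 0 \<Rightarrow> (\<lambda>\<omega>. V s) | Suc i \<Rightarrow> fst (p i))" for t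
  define J where "J t = snd (p t)" for t
  have Vs: "\<bar>V s\<bar> \<le> \<bar>b\<bar>" using V(2)[OF s] by linarith
  have w: "w t \<in> borel_measurable P" "\<bar>w t \<omega>\<bar> \<le> \<bar>b\<bar>" for t \<omega>
    unfolding w_def using p(1,2) Vs by (cases t; simp)+
  have wV: "AE \<omega> in P. w t \<omega> = V (state t \<omega>)" for t
  proof (cases t)
    case 0
    show ?thesis using PD(3) by eventually_elim (simp add: w_def 0)
  qed (use p(4) in \<open>simp add: w_def\<close>)
  have J: "integrable P (J t)" "AE \<omega> in P. J t \<omega> = (\<integral>s'. V s' \<partial>completion (trans M (state t \<omega>) (act t \<omega>)))"
    "(\<integral>\<omega>. w (Suc t) \<omega> \<partial>P) = (\<integral>\<omega>. J t \<omega> \<partial>P)" for t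
    unfolding J_def w_def using p(3,5,6)[of t] by simp_all
  have wint: "integrable P (w t)" for t
    by (rule integrable_const_bound[of _ "\<bar>b\<bar>", OF _ w(1)]) (simp add: w(2))
  have \<rho>int: "integrable P (\<rho> t)" for t
    by (rule integrable_const_bound[of _ "\<bar>R\<bar>", OF _ \<rho>(1)]) (simp add: \<rho>(2))
  define e where "e t = (\<integral>\<omega>. \<rho> t \<omega> \<partial>P)" for t
  define v where "v t = (\<integral>\<omega>. w t \<omega> \<partial>P)" for t
  have v0: "v 0 = V s" by (simp add: v_def w_def prob_space)
  have vb: "\<bar>v t\<bar> \<le> \<bar>b\<bar>" for t
  proof -
    have "\<bar>v t\<bar> \<le> (\<integral>\<omega>. \<bar>w t \<omega>\<bar> \<partial>P)" unfolding v_def by (rule integral_abs_bound)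
    also have "\<dots> \<le> \<bar>b\<bar>" by (rule integral_le_const) (use wint w(2) in auto)
    finally show ?thesis .
  qed
  have QJ: "AE \<omega> in P. \<rho> t \<omega> + ?\<beta> * J t \<omega> = Q M (state t (hist t \<omega>)) (\<sigma> t (hist t \<omega>)) V \<and>
      w t \<omega> = V (state t (hist t \<omega>)) \<and> hist t \<omega> \<in> space (Hist M t)" for t
    using \<rho>(3)[of t] J(2)[of t] wV[of t] PD(4)[of t] AE_space
    by eventually_elim (simp add: Q_def measurable_space[OF hP])
  have sum_int: "(\<integral>\<omega>. \<rho> t \<omega> + ?\<beta> * J t \<omega> \<partial>P) = e t + ?\<beta> * v (Suc t)" for t
    using \<rho>int[of t] J(1)[of t] by (simp add: e_def v_def J(3))
  have rec_le: "e t + ?\<beta> * v (Suc t) \<le> v t" for t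
    unfolding sum_int[symmetric] unfolding v_def
  proof (rule integral_mono_AE)
    show "AE \<omega> in P. \<rho> t \<omega> + ?\<beta> * J t \<omega> \<le> w t \<omega>"
      using QJ[of t]
    proof eventually_elim
      case (elim \<omega>)
      then have h: "hist t \<omega> \<in> space (Hist M t)" by blast
      have "Q M (state t (hist t \<omega>)) (\<sigma> t (hist t \<omega>)) V \<le> V (state t (hist t \<omega>))"
        by (rule Q[OF space_Hist_memD(2)[OF h] strategiesD(2)[OF \<sigma> h]])
      then show ?case using elim by linarith
    qed
  qed (use \<rho>int J(1) wint in auto)
  have eb: "\<bar>e t\<bar> \<le> \<bar>R\<bar>" for t
  proof -
    have "\<bar>e t\<bar> \<le> (\<integral>\<omega>. \<bar>\<rho> t \<omega>\<bar> \<partial>P)" unfolding e_def by (rule integral_abs_bound)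
    also have "\<dots> \<le> \<bar>R\<bar>" by (rule integral_le_const) (use \<rho>int \<rho>(2) in auto)
    finally show ?thesis .
  qed
  have geo: "summable (\<lambda>t. ?\<beta> ^ t * c)" for c
    using \<beta> by (intro summable_mult2 summable_geometric) simp
  have dom: "summable (\<lambda>t. ?\<beta> ^ t * f t)" "summable (\<lambda>t. norm (?\<beta> ^ t * f t))"
    if "\<And>t. \<bar>f t\<bar> \<le> \<bar>R\<bar>" for f
  proof -
    have "norm (?\<beta> ^ t * f t) \<le> ?\<beta> ^ t * \<bar>R\<bar>" for t
      using \<beta> that[of t] by (simp add: abs_mult power_abs mult_left_mono)
    then show "summable (\<lambda>t. ?\<beta> ^ t * f t)" "summable (\<lambda>t. norm (?\<beta> ^ t * f t))"
      by (auto intro!: summable_comparison_test'[OF geo[of "\<bar>R\<bar>"]])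
  qed
  \<comment> \<open>The payoffs agree with their bounded versions at all dates simultaneously
    outside one null set. A geometric series dominates, so the sum and the integral can be
    exchanged.\<close>
  have val_eq: "strategy_value M \<sigma> s = ereal (\<Sum>t. ?\<beta> ^ t * e t)"
  proof -
    have m: "(\<lambda>\<omega>. ?\<beta> ^ t * \<rho> t \<omega>) \<in> borel_measurable P" "integrable P (\<lambda>\<omega>. ?\<beta> ^ t * \<rho> t \<omega>)" for t
      using \<rho>(1) \<rho>int by auto
    have ae: "AE \<omega> in P. summable (\<lambda>t. norm (?\<beta> ^ t * \<rho> t \<omega>))"
      by (rule AE_I2) (rule dom(2)[OF \<rho>(2)])
    have nb: "norm (\<integral>\<omega>. norm (?\<beta> ^ t * \<rho> t \<omega>) \<partial>P) \<le> ?\<beta> ^ t * \<bar>R\<bar>" for t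
    proof -
      have "(\<integral>\<omega>. norm (?\<beta> ^ t * \<rho> t \<omega>) \<partial>P) \<le> ?\<beta> ^ t * \<bar>R\<bar>"
        by (rule integral_le_const)
           (use m(2)[of t] \<beta> \<rho>(2)[of t] in \<open>auto simp: abs_mult power_abs intro!: AE_I2 mult_left_mono integrable_norm\<close>)
      then show ?thesis by (simp add: integral_nonneg_AE)
    qed
    have sm: "summable (\<lambda>t. \<integral>\<omega>. norm (?\<beta> ^ t * \<rho> t \<omega>) \<partial>P)"
      by (rule summable_comparison_test'[OF geo[of "\<bar>R\<bar>"] nb])
    have "expect P (\<lambda>\<omega>. \<Sum>t. ereal (?\<beta> ^ t * payoff M (state t \<omega>) (act t \<omega>))) =
        ereal (\<integral>\<omega>. (\<Sum>t. ?\<beta> ^ t * \<rho> t \<omega>) \<partial>P)"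
    proof (rule expect_eq_integral)
      show "integrable P (\<lambda>\<omega>. \<Sum>t. ?\<beta> ^ t * \<rho> t \<omega>)"
        by (rule integrable_suminf[OF m(2) ae sm])
      have "AE \<omega> in P. \<forall>t. \<rho> t \<omega> = payoff M (state t \<omega>) (act t \<omega>)"
        unfolding AE_all_countable using \<rho>(3) by blast
      then show "AE \<omega> in P. (\<Sum>t. ereal (?\<beta> ^ t * payoff M (state t \<omega>) (act t \<omega>))) =
          ereal (\<Sum>t. ?\<beta> ^ t * \<rho> t \<omega>)"
      proof eventually_elim
        case (elim \<omega>)
        have "(\<lambda>t. ereal (?\<beta> ^ t * \<rho> t \<omega>)) sums ereal (\<Sum>t. ?\<beta> ^ t * \<rho> t \<omega>)"
          unfolding sums_ereal by (rule summable_sums[OF dom(1)[OF \<rho>(2)]])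
        from sums_unique[OF this] show ?case using elim by simp
      qed
    qed
    also have "(\<integral>\<omega>. (\<Sum>t. ?\<beta> ^ t * \<rho> t \<omega>) \<partial>P) = (\<Sum>t. (\<integral>\<omega>. ?\<beta> ^ t * \<rho> t \<omega> \<partial>P))"
      by (rule integral_suminf[OF m(2) ae sm])
    also have "\<dots> = (\<Sum>t. ?\<beta> ^ t * e t)" by (simp add: e_def)
    finally show ?thesis unfolding strategy_value_def induced_admissible[OF \<sigma> s P] .
  qed
  \<comment> \<open>Boundedness of \<open>V\<close> enters here: the discounted remainder
    \<open>?\<beta> ^ t * v t\<close> tends to 0.\<close>
  have tel: "(\<lambda>t. ?\<beta> ^ t * v t - ?\<beta> ^ Suc t * v (Suc t)) sums (V s - 0)"
  proof -
    have "(\<lambda>t. ?\<beta> ^ t * v t) \<longlonglongrightarrow> 0"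
    proof (rule Lim_null_comparison)
      show "\<forall>\<^sub>F t in sequentially. norm (?\<beta> ^ t * v t) \<le> ?\<beta> ^ t * \<bar>b\<bar>"
        using \<beta> vb by (auto simp: abs_mult power_abs intro!: always_eventually mult_left_mono)
      show "(\<lambda>t. ?\<beta> ^ t * \<bar>b\<bar>) \<longlonglongrightarrow> 0" by (rule summable_LIMSEQ_zero[OF geo])
    qed
    from telescope_sums'[OF this] show ?thesis by (simp add: v0)
  qed
  have step: "?\<beta> ^ t * v t - ?\<beta> ^ Suc t * v (Suc t) = ?\<beta> ^ t * (v t - ?\<beta> * v (Suc t))" for t
    by (simp add: algebra_simps)
  have "(\<Sum>t. ?\<beta> ^ t * e t) \<le> V s - 0"
  proof (rule sums_le[OF _ summable_sums[OF dom(1)[OF eb]] tel])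
    fix t
    have "e t \<le> v t - ?\<beta> * v (Suc t)" using rec_le[of t] by linarith
    then show "?\<beta> ^ t * e t \<le> ?\<beta> ^ t * v t - ?\<beta> ^ Suc t * v (Suc t)"
      unfolding step using \<beta> by (intro mult_left_mono) auto
  qed
  then show "strategy_value M \<sigma> s \<le> ereal (V s)" by (simp add: val_eq)
  assume Qeq: "\<And>t h. h \<in> space (Hist M t) \<Longrightarrow> Q M (state t h) (\<sigma> t h) V = V (state t h)"
  have rec_eq: "e t + ?\<beta> * v (Suc t) = v t" for t
    unfolding sum_int[symmetric] unfolding v_def
  proof (rule integral_cong_AE)
    show "AE \<omega> in P. \<rho> t \<omega> + ?\<beta> * J t \<omega> = w t \<omega>"
      using QJ[of t]
    proof eventually_elim
      case (elim \<omega>)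
      then have "Q M (state t (hist t \<omega>)) (\<sigma> t (hist t \<omega>)) V = V (state t (hist t \<omega>))" by (intro Qeq) blast
      then show ?case using elim by linarith
    qed
  qed (use \<rho>(1) J(1) w(1) in auto)
  have "?\<beta> ^ t * v t - ?\<beta> ^ Suc t * v (Suc t) = ?\<beta> ^ t * e t" for t
    unfolding step using rec_eq[of t] by simp
  then have "(\<lambda>t. ?\<beta> ^ t * e t) sums (V s - 0)" using tel by simp
  then show "strategy_value M \<sigma> s = ereal (V s)" by (simp add: val_eq sums_unique[symmetric])
qed

end

section \<open>The Bellman operator\<close>

context ddp_theory
begin

lemma BmD:
  assumes "f \<in> Bm M"
  shows "f \<in> UM (mode M) (SB M) \<rightarrow>\<^sub>M borel" "f \<in> extensional (states M)"
    "f \<in> mspace (funspace (states M) euclidean_metric)" "\<exists>b. \<forall>x\<in>states M. \<bar>f x\<bar> \<le> b"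
proof -
  show f: "f \<in> mspace (funspace (states M) euclidean_metric)" and "f \<in> UM (mode M) (SB M) \<rightarrow>\<^sub>M borel"
    using assms by (auto simp: Bm_def umeas_eq_measurable)
  show "f \<in> extensional (states M)" by (rule funspace_imp_extensional[OF f])
  show "\<exists>b. \<forall>x\<in>states M. \<bar>f x\<bar> \<le> b"
  proof (cases "states M = {}")
    case False
    then obtain c B where "\<forall>x\<in>states M. dist c (f x) \<le> B"
      using funspace_imp_bounded[OF f] by auto
    then have "\<forall>x\<in>states M. \<bar>f x\<bar> \<le> B + \<bar>c\<bar>" by (auto simp: dist_real_def)
    then show ?thesis by blast
  qed simp
qed

text \<open>Monotonicity and discounting of the operator in one inequality: integrating against a
  probability measure preserves the upper bound \<open>d\<close>. It is one-sided so that it can be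
  used with \<open>f\<close> and \<open>g\<close> in either order.\<close>

lemma Q_diff_le:
  assumes f: "f \<in> Bm M" and g: "g \<in> Bm M" and x: "x \<in> states M" "a \<in> \<Gamma> M x"
    and d: "\<And>y. y \<in> states M \<Longrightarrow> f y - g y \<le> d"
  shows "Q M x a f - Q M x a g \<le> discount M * d"
proof -
  let ?T = "completion (trans M x a)"
  have a: "a \<in> actions M" using x by (simp add: \<Gamma>_def)
  interpret T: prob_space "trans M x a" by (rule trans_prob[OF x(1) a])
  interpret c: prob_space ?T by (rule prob_spaceI) (simp add: T.emeasure_space_1)
  have sp: "space ?T = states M" using trans_prob(3)[OF x(1) a] by simp
  have int: "integrable ?T h" if h: "h \<in> Bm M" for h
  proof -
    obtain b where "\<forall>x\<in>states M. \<bar>h x\<bar> \<le> b" using BmD(4)[OF h] by blast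
    moreover have "h \<in> borel_measurable ?T"
      by (rule measurable_completion_UM[OF usets_trans[OF x] trans_prob(2)[OF x(1) a] BmD(1)[OF h]])
    ultimately show ?thesis
      by (intro c.integrable_const_bound[of _ b] AE_I2) (auto simp: sp[simplified])
  qed
  have "(\<integral>y. f y \<partial>?T) - (\<integral>y. g y \<partial>?T) = (\<integral>y. f y - g y \<partial>?T)"
    by (rule Bochner_Integration.integral_diff[symmetric]) (rule int[OF f], rule int[OF g])
  also have "\<dots> \<le> d"
    by (rule c.integral_le_const) (use int[OF f] int[OF g] d sp in \<open>auto intro!: AE_I2\<close>)
  finally have "discount M * ((\<integral>y. f y \<partial>?T) - (\<integral>y. g y \<partial>?T)) \<le> discount M * d"
    using discount by (intro mult_left_mono) auto
  then show ?thesis by (simp add: Q_def algebra_simps)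
qed

section \<open>Stationary strategies, maximisers and the fixed point\<close>

lemma stationary_strategy:
  assumes "stationary_policy M l"
  shows "stationary_strategy l \<in> strategies M"
proof -
  have l: "l \<in> UM (mode M) (SB M) \<rightarrow>\<^sub>M AB M" "\<And>s. s \<in> states M \<Longrightarrow> l s \<in> \<Gamma> M s"
    using assms by (auto simp: stationary_policy_def umeas_eq_measurable)
  have "stationary_strategy l t \<in> UM (mode M) (Hist M t) \<rightarrow>\<^sub>M AB M" for t
    unfolding stationary_strategy_def[abs_def]
    by (rule UM_compose[OF measurable_UM[OF measurable_state] l(1)])
  moreover have "stationary_strategy l t h \<in> \<Gamma> M (state t h)" if "h \<in> space (Hist M t)" for t h
    unfolding stationary_strategy_def by (rule l(2)[OF space_Hist_memD(2)[OF that]])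
  ultimately show ?thesis unfolding strategies_def umeas_eq_measurable by blast
qed

lemma \<Lambda>D:
  assumes "l \<in> \<Lambda> M f"
  shows "stationary_policy M l" "s \<in> states M \<Longrightarrow> bellman M f s = ereal (Q M s (l s) f)"
  using assms by (auto simp: \<Lambda>_def stationary_policy_def)

lemma Q_le_bellman: "a \<in> \<Gamma> M s \<Longrightarrow> ereal (Q M s a f) \<le> bellman M f s"
  unfolding bellman_def by (rule SUP_upper)

text \<open>Both sides are compared at an action that is maximal for \<open>f\<close>: there
  \<open>f\<close> attains its supremum, and \<open>g\<close> stays below its own.\<close>

lemma bellman_diff_le:
  assumes f: "f \<in> Bm M" and g: "g \<in> Bm M" and l: "l \<in> \<Lambda> M f" and x: "x \<in> states M"
    and Tf: "bellman M f x = ereal u" and Tg: "bellman M g x = ereal v"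
    and d: "\<And>y. y \<in> states M \<Longrightarrow> f y - g y \<le> d"
  shows "u - v \<le> discount M * d"
proof -
  have lx: "l x \<in> \<Gamma> M x" using \<Lambda>D(1)[OF l] x by (simp add: stationary_policy_def)
  have "u = Q M x (l x) f" using \<Lambda>D(2)[OF l x] Tf by simp
  moreover have "Q M x (l x) g \<le> v" using Q_le_bellman[OF lx, of g] Tg by simp
  ultimately show ?thesis using Q_diff_le[OF f g x lx d] by simp
qed

lemma bellman_fixpoint:
  assumes D: "D \<subseteq> Bm M" "D \<noteq> {}"
    and complete: "mcomplete_of (submetric (funspace (states M) euclidean_metric) D)"
    and T: "\<And>f. f \<in> D \<Longrightarrow> \<Lambda> M f \<noteq> {} \<and> (\<exists>g\<in>D. equals_on (states M) (bellman M f) g)"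
  obtains V where "V \<in> D" "equals_on (states M) (bellman M V) V"
proof -
  let ?m = "submetric (funspace (states M) euclidean_metric) D"
  \<comment> \<open>The operator has extended real values; \<open>\<Phi>\<close> is its real-valued
    form, taken inside \<open>D\<close>.\<close>
  have "\<forall>f\<in>D. \<exists>g. g \<in> D \<and> equals_on (states M) (bellman M f) g" using T by blast
  from bchoice[OF this] obtain \<Phi> where \<Phi>: "\<And>f. f \<in> D \<Longrightarrow> \<Phi> f \<in> D"
    "\<And>f. f \<in> D \<Longrightarrow> equals_on (states M) (bellman M f) (\<Phi> f)" by blast
  have sp: "mspace ?m = D" using D BmD(3) by (auto simp del: mspace_funspace)
  interpret N: Metric_space "mspace ?m" "mdist ?m" by (rule Metric_space_mspace_mdist)
  have dist_le: "mdist ?m f g \<le> e \<longleftrightarrow> (\<forall>x\<in>states M. \<bar>f x - g x\<bar> \<le> e)"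
    if "f \<in> D" "g \<in> D" "states M \<noteq> {}" for f g e
    using funspace_mdist_le[OF BmD(3) BmD(3) that(3), of f g e] that D
    by (auto simp: dist_real_def simp del: mspace_funspace mdist_funspace)
  have con: "mdist ?m (\<Phi> f) (\<Phi> g) \<le> discount M * mdist ?m f g" if f: "f \<in> D" and g: "g \<in> D" for f g
  proof (cases "states M = {}")
    \<comment> \<open>The description of the sup-metric by pointwise bounds is available only for a
      non-empty state space. Over the empty one, extensionality leaves a single function.\<close>
    case True
    have "\<Phi> f \<in> extensional {}" "\<Phi> g \<in> extensional {}"
      using BmD(2) \<Phi>(1)[OF f] \<Phi>(1)[OF g] D(1) True by (metis subsetD)+
    then have "\<Phi> f = \<Phi> g" by simp
    then have "mdist ?m (\<Phi> f) (\<Phi> g) = 0" using N.zero \<Phi>(1)[OF f] \<Phi>(1)[OF g] sp by metis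
    then show ?thesis using discount N.nonneg[of f g] by simp
  next
    case False
    have d: "\<bar>f x - g x\<bar> \<le> mdist ?m f g" if "x \<in> states M" for x
      using dist_le[OF f g False, of "mdist ?m f g"] that by blast
    have fg: "f \<in> Bm M" "g \<in> Bm M" using f g D by auto
    obtain l l' where l: "l \<in> \<Lambda> M f" "l' \<in> \<Lambda> M g" using T[OF f] T[OF g] by blast
    have "\<bar>\<Phi> f x - \<Phi> g x\<bar> \<le> discount M * mdist ?m f g" if x: "x \<in> states M" for x
    proof -
      have e: "bellman M f x = ereal (\<Phi> f x)" "bellman M g x = ereal (\<Phi> g x)"
        using \<Phi>(2)[OF f] \<Phi>(2)[OF g] x by (auto simp: equals_on_def)
      have "f y - g y \<le> mdist ?m f g" "g y - f y \<le> mdist ?m f g" if "y \<in> states M" for y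
        using d[OF that] by linarith+
      then have "\<Phi> f x - \<Phi> g x \<le> discount M * mdist ?m f g" "\<Phi> g x - \<Phi> f x \<le> discount M * mdist ?m f g"
        using bellman_diff_le[OF fg l(1) x e] bellman_diff_le[OF fg(2,1) l(2) x e(2,1)] by blast+
      then show ?thesis by linarith
    qed
    then show ?thesis using dist_le[OF \<Phi>(1)[OF f] \<Phi>(1)[OF g] False] by blast
  qed
  have "N.mcomplete" using complete unfolding mcomplete_of_def .
  then obtain V where V: "V \<in> mspace ?m" "\<Phi> V = V"
  proof (rule N.Banach_fixedpoint_thm)
    show "mspace ?m \<noteq> {}" unfolding sp by (rule D(2))
    show "\<Phi> \<in> mspace ?m \<rightarrow> mspace ?m" unfolding sp using \<Phi>(1) by blast
    show "discount M < 1" by (rule discount)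
    show "mdist ?m (\<Phi> f) (\<Phi> g) \<le> discount M * mdist ?m f g" if "f \<in> mspace ?m" "g \<in> mspace ?m" for f g
      using con that unfolding sp by blast
  qed
  have "V \<in> D" using V(1) unfolding sp .
  then show thesis using that \<Phi>(2)[of V] V(2) by simp
qed

text \<open>The upper bound is limited to feasible pairs because the supremum defining the operator
  ranges over these; the lower bound is part of the model.\<close>

lemma payoff_bounded:
  assumes T0: "equals_on (states M) (bellman M (\<lambda>s\<in>states M. 0)) g" and g: "g \<in> Bm M"
  shows "\<exists>R. \<forall>x\<in>states M. \<forall>a\<in>\<Gamma> M x. \<bar>payoff M x a\<bar> \<le> R"
proof -
  obtain c where c: "\<And>s a. s \<in> states M \<Longrightarrow> a \<in> actions M \<Longrightarrow> c \<le> payoff M s a"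
    using model unfolding ddp_model_def by blast
  obtain b where b: "\<And>x. x \<in> states M \<Longrightarrow> \<bar>g x\<bar> \<le> b" using BmD(4)[OF g] by blast
  have "\<bar>payoff M x a\<bar> \<le> \<bar>b\<bar> + \<bar>c\<bar>" if x: "x \<in> states M" and a: "a \<in> \<Gamma> M x" for x a
  proof -
    have a': "a \<in> actions M" using a by (simp add: \<Gamma>_def)
    have "(\<integral>s'. (\<lambda>s\<in>states M. 0 :: real) s' \<partial>completion (trans M x a)) =
        (\<integral>s'. 0 \<partial>completion (trans M x a))"
      by (rule Bochner_Integration.integral_cong) (auto simp: trans_prob(3)[OF x a'])
    then have "Q M x a (\<lambda>s\<in>states M. 0) = payoff M x a" by (simp add: Q_def)
    moreover have "ereal (Q M x a (\<lambda>s\<in>states M. 0)) \<le> ereal (g x)"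
      using Q_le_bellman[OF a, of "\<lambda>s\<in>states M. 0"] T0 x by (simp add: equals_on_def)
    ultimately have "payoff M x a \<le> g x" by simp
    then show ?thesis using b[OF x] c[OF x a'] by linarith
  qed
  then show ?thesis by blast
qed

end

theorem theorem1:
  fixes M :: "('s::polish_space, 'a::polish_space) ddp"
    and D :: "('s \<Rightarrow> real) set"
  assumes "ddp_model M"
    and "D \<subseteq> Bm M"
    and "mcomplete_of (submetric (funspace (states M) euclidean_metric) D)"
    and "(\<lambda>s\<in>states M. 0) \<in> D"
    and "\<forall>f\<in>D. (\<lambda>s\<in>states M. SUP s'\<in>states M. f s') \<in> D"
    and "\<forall>f\<in>D. \<Lambda> M f \<noteq> {} \<and> (\<exists>g\<in>D. equals_on (states M) (bellman M f) g)"
  shows "\<exists>V\<in>D. equals_on (states M) (value_function M) V \<and>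
           equals_on (states M) (bellman M V) V \<and>
           (\<forall>f\<in>D. equals_on (states M) (bellman M f) f \<longrightarrow> f = V) \<and>
           (\<exists>l\<in>\<Lambda> M V. stationary_policy M l \<and> eps_optimal M (stationary_strategy l)) \<and>
           (\<forall>l\<in>\<Lambda> M V. (\<forall>s\<in>states M. bellman M V s = ereal (Q M s (l s) V)) \<longrightarrow>
              stationary_policy M l \<and> optimal M (stationary_strategy l))"
proof -
  interpret ddp_theory M by unfold_locales (rule assms(1))
  have T: "\<Lambda> M f \<noteq> {} \<and> (\<exists>g\<in>D. equals_on (states M) (bellman M f) g)" if "f \<in> D" for f
    using assms(6) that by blast
  obtain g where "g \<in> D" "equals_on (states M) (bellman M (\<lambda>s\<in>states M. 0)) g"
    using T[OF assms(4)] by blast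
  then obtain R where R: "\<And>x a. x \<in> states M \<Longrightarrow> a \<in> \<Gamma> M x \<Longrightarrow> \<bar>payoff M x a\<bar> \<le> R"
    using payoff_bounded assms(2) by blast
  have "D \<noteq> {}" using assms(4) by blast
  then obtain V where V: "V \<in> D" "equals_on (states M) (bellman M V) V"
    using bellman_fixpoint[OF assms(2) _ assms(3) T] by blast
  \<comment> \<open>This is proved for an arbitrary fixed point in \<open>D\<close>, not only for
    \<open>V\<close>: every fixed point then equals the value function on the states, which is what
    gives uniqueness.\<close>
  have fixpoint: "(\<forall>\<sigma>\<in>strategies M. \<forall>s\<in>states M. strategy_value M \<sigma> s \<le> ereal (f s)) \<and>
      (\<forall>l\<in>\<Lambda> M f. \<forall>s\<in>states M. strategy_value M (stationary_strategy l) s = ereal (f s))"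
    if f: "f \<in> D" "equals_on (states M) (bellman M f) f" for f
  proof -
    have fB: "f \<in> Bm M" using f assms(2) by blast
    obtain b where b: "\<And>x. x \<in> states M \<Longrightarrow> \<bar>f x\<bar> \<le> b" using BmD(4)[OF fB] by blast
    have Qf: "Q M x a f \<le> f x" if "x \<in> states M" "a \<in> \<Gamma> M x" for x a
      using Q_le_bellman[OF that(2), of f] f(2) that(1) by (simp add: equals_on_def)
    have "strategy_value M \<sigma> s \<le> ereal (f s)" if "\<sigma> \<in> strategies M" "s \<in> states M" for \<sigma> s
      by (rule verification(1)[OF that BmD(1)[OF fB] b R Qf])
    moreover have "strategy_value M (stationary_strategy l) s = ereal (f s)"
      if l: "l \<in> \<Lambda> M f" and s: "s \<in> states M" for l s
    proof (rule verification(2)[OF stationary_strategy[OF \<Lambda>D(1)[OF l]] s BmD(1)[OF fB] b R Qf])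
      fix t h assume "h \<in> space (Hist M t)"
      then have "state t h \<in> states M" by (rule space_Hist_memD)
      then show "Q M (state t h) (stationary_strategy l t h) f = f (state t h)"
        using \<Lambda>D(2)[OF l] f(2) by (simp add: stationary_strategy_def equals_on_def)
    qed
    ultimately show ?thesis by blast
  qed
  have value_fixpoint: "equals_on (states M) (value_function M) f"
    if f: "f \<in> D" "equals_on (states M) (bellman M f) f" for f
    unfolding equals_on_def value_function_def
  proof (intro ballI antisym SUP_least)
    fix s assume s: "s \<in> states M"
    show "strategy_value M \<sigma> s \<le> ereal (f s)" if "\<sigma> \<in> strategies M" for \<sigma>
      using fixpoint[OF f] that s by blast
    obtain l where l: "l \<in> \<Lambda> M f" using T[OF f(1)] by blast
    have "ereal (f s) = strategy_value M (stationary_strategy l) s" using fixpoint[OF f] l s by simp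
    also have "\<dots> \<le> (SUP \<sigma>\<in>strategies M. strategy_value M \<sigma> s)"
      by (rule SUP_upper) (rule stationary_strategy[OF \<Lambda>D(1)[OF l]])
    finally show "ereal (f s) \<le> (SUP \<sigma>\<in>strategies M. strategy_value M \<sigma> s)" .
  qed
  have unique: "f = V" if f: "f \<in> D" "equals_on (states M) (bellman M f) f" for f
  \<comment> \<open>Both functions are extensional, so agreement on the states is equality.\<close>
  proof (rule extensionalityI[of _ "states M"])
    show "f \<in> extensional (states M)" "V \<in> extensional (states M)"
      using f V(1) assms(2) BmD(2) by blast+
    show "f s = V s" if "s \<in> states M" for s
      using value_fixpoint[OF f] value_fixpoint[OF V] that by (simp add: equals_on_def)
  qed
  \<comment> \<open>Each maximiser attains \<open>V\<close> exactly, and no strategy exceeds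
    \<open>V\<close>; optimality and the bound for every positive \<open>\<epsilon>\<close> follow
    together.\<close>
  have opt: "stationary_policy M l \<and> optimal M (stationary_strategy l) \<and> eps_optimal M (stationary_strategy l)"
    if l: "l \<in> \<Lambda> M V" for l
  proof -
    have st: "stationary_strategy l \<in> strategies M" by (rule stationary_strategy[OF \<Lambda>D(1)[OF l]])
    have eq: "strategy_value M (stationary_strategy l) s = ereal (V s)" if "s \<in> states M" for s
      using fixpoint[OF V] l that by blast
    have "strategy_value M \<sigma>' s \<le> strategy_value M (stationary_strategy l) s + ereal \<epsilon>"
      if "0 < \<epsilon>" "\<sigma>' \<in> strategies M" "s \<in> states M" for \<epsilon> \<sigma>' s
    proof -
      have "strategy_value M \<sigma>' s \<le> ereal (V s)" using fixpoint[OF V] that by blast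
      also have "\<dots> \<le> ereal (V s) + ereal \<epsilon>" using that by simp
      finally show ?thesis using eq[OF that(3)] by simp
    qed
    then show ?thesis
      using st eq \<Lambda>D(1)[OF l] value_fixpoint[OF V]
      by (auto simp: optimal_def eps_optimal_def equals_on_def)
  qed
  obtain l where "l \<in> \<Lambda> M V" using T[OF V(1)] by blast
  then show ?thesis
    using V value_fixpoint[OF V] unique opt by (intro bexI[OF _ V(1)] conjI) blast+
qed

end
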